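(* There exists an extended linear formulation for the polytope $P_1$ with $O(TS^2)$ variables and $O(TS^2)$ constraints.
   Context: Let $T\ge1$, $\mathcal T=\{1,\dots,T\}$, finite nonnegative reals $L^s_t,U^s_t,L^x_t,U^x_t,L^y_t,U^y_t$ ($t\in\mathcal T$) and a given initial stock $s_0$. $Q_1$ is the set of $(x,y,s,w,z)$, $x,y,s\in\mathbb R^{\mathcal T}$, $w,z\in\{0,1\}^{\mathcal T}$, with for all $t$: $s_t=s_{t-1}-y_t+x_t$, $x_ty_t=0$, $L^s_t\le s_t\le U^s_t$, $L^y_tz_t\le y_t\le U^y_tz_t$, $L^x_tw_t\le x_t\le U^x_tw_t$; $P_1=\mathrm{conv}(Q_1)$. For $t\in\mathcal T$ let $S_t=(A_t\cup B_t)\cap[L^s_t,U^s_t]$ where $A_t=\{K-\sum_{i=1}^t(v^1_iL^y_i+v^2_iU^y_i)+\sum_{i=1}^t(u^1_iL^x_i+u^2_iU^x_i): K\in\{s_0,U^s_1,\dots,U^s_t,L^s_1,\dots,L^s_t\},\ v^1,v^2,u^1,u^2\in\{0,1\}^t,\ v^1_i+v^2_i+u^1_i+u^2_i\le1\ \forall i\}$ and $B_t=\{K'+\sum_{i=t+1}^T(v^3_iL^y_i+v^4_iU^y_i)-\sum_{i=t+1}^T(u^3_iL^x_i+u^4_iU^x_i): K'\in\{U^s_{t+1},\dots,U^s_T,L^s_{t+1},\dots,L^s_T\},\ v^3,v^4,u^3,u^4\in\{0,1\}^{\{t+1,\dots,T\}},\ v^3_i+v^4_i+u^3_i+u^4_i\le1\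 \forall i\}$, and $S=\max_{t\in\mathcal T}|S_t|$. An extended linear formulation of $P_1$ is a polyhedron described by linear constraints in the variables $(x,y,s,w,z)$ and additional variables whose projection onto $(x,y,s,w,z)$ equals $P_1$. *)

theory Defs
  imports "HOL-Analysis.Analysis" "HOL-Analysis.Finite_Function_Topology"
begin

text \<open>
  The horizon \<open>T\<close> has to be quantified inside the statement (the \<open>O\<close>-constant must not depend
  on it), so \<open>\<real>\<^sup>I\<close> for a set of indices \<open>I\<close> is rendered as a subspace of the real vector space of
  finitely supported functions \<open>nat \<Rightarrow>\<^sub>0 real\<close> rather than by a type.
\<close>

definition coord_space :: "nat set \<Rightarrow> (nat \<Rightarrow>\<^sub>0 real) set" where
  "coord_space I = {f. Poly_Mapping.keys f \<subseteq> I}"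

type_synonym point =
  "(nat \<Rightarrow>\<^sub>0 real) \<times> (nat \<Rightarrow>\<^sub>0 real) \<times> (nat \<Rightarrow>\<^sub>0 real) \<times> (nat \<Rightarrow>\<^sub>0 real) \<times> (nat \<Rightarrow>\<^sub>0 real)"

definition point_space :: "nat \<Rightarrow> point set" where
  "point_space T = coord_space {1..T} \<times> coord_space {1..T} \<times> coord_space {1..T}
                     \<times> coord_space {1..T} \<times> coord_space {1..T}"

text \<open>Only the values of the bounds at the periods \<open>1, \<dots>, T\<close> matter.\<close>

record stock_data =
  horizon :: nat
  init_stock :: real
  Ls :: "nat \<Rightarrow> real"
  Us :: "nat \<Rightarrow> real"
  Lx :: "nat \<Rightarrow> real"
  Ux :: "nat \<Rightarrow> real"
  Ly :: "nat \<Rightarrow> real"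
  Uy :: "nat \<Rightarrow> real"

definition valid_data :: "stock_data \<Rightarrow> bool" where
  "valid_data D \<longleftrightarrow> horizon D \<ge> 1 \<and>
     (\<forall>t\<in>{1..horizon D}. 0 \<le> Ls D t \<and> 0 \<le> Us D t \<and> 0 \<le> Lx D t \<and> 0 \<le> Ux D t
                        \<and> 0 \<le> Ly D t \<and> 0 \<le> Uy D t)"

definition prev_stock :: "stock_data \<Rightarrow> (nat \<Rightarrow>\<^sub>0 real) \<Rightarrow> nat \<Rightarrow> real" where
  "prev_stock D s t = (if t = 1 then init_stock D else Poly_Mapping.lookup s (t - 1))"

definition Q1 :: "stock_data \<Rightarrow> point set" where
  "Q1 D = {(x, y, s, w, z). (x, y, s, w, z) \<in> point_space (horizon D) \<and>
     (\<forall>t\<in>{1..horizon D}.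
        Poly_Mapping.lookup w t \<in> {0, 1} \<and> Poly_Mapping.lookup z t \<in> {0, 1} \<and>
        Poly_Mapping.lookup s t
          = prev_stock D s t - Poly_Mapping.lookup y t + Poly_Mapping.lookup x t \<and>
        Poly_Mapping.lookup x t * Poly_Mapping.lookup y t = 0 \<and>
        Ls D t \<le> Poly_Mapping.lookup s t \<and> Poly_Mapping.lookup s t \<le> Us D t \<and>
        Ly D t * Poly_Mapping.lookup z t \<le> Poly_Mapping.lookup y t \<and>
        Poly_Mapping.lookup y t \<le> Uy D t * Poly_Mapping.lookup z t \<and>
        Lx D t * Poly_Mapping.lookup w t \<le> Poly_Mapping.lookup x t \<and>
        Poly_Mapping.lookup x t \<le> Ux D t * Poly_Mapping.lookup w t)}"

definition P1 :: "stock_data \<Rightarrow> point set" where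
  "P1 D = convex hull (Q1 D)"

definition forward_levels :: "stock_data \<Rightarrow> nat \<Rightarrow> real set" where
  "forward_levels D t =
     {K - (\<Sum>i\<in>{1..t}. v1 i * Ly D i + v2 i * Uy D i)
        + (\<Sum>i\<in>{1..t}. u1 i * Lx D i + u2 i * Ux D i) | K v1 v2 u1 u2.
      K \<in> {init_stock D} \<union> Us D ` {1..t} \<union> Ls D ` {1..t} \<and>
      v1 \<in> {1..t} \<rightarrow> {0, 1} \<and> v2 \<in> {1..t} \<rightarrow> {0, 1} \<and>
      u1 \<in> {1..t} \<rightarrow> {0, 1} \<and> u2 \<in> {1..t} \<rightarrow> {0, 1} \<and>
      (\<forall>i\<in>{1..t}. v1 i + v2 i + u1 i + u2 i \<le> 1)}"

definition backward_levels :: "stock_data \<Rightarrow> nat \<Rightarrow> real set" where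
  "backward_levels D t =
     {K' + (\<Sum>i\<in>{t+1..horizon D}. v3 i * Ly D i + v4 i * Uy D i)
         - (\<Sum>i\<in>{t+1..horizon D}. u3 i * Lx D i + u4 i * Ux D i) | K' v3 v4 u3 u4.
      K' \<in> Us D ` {t+1..horizon D} \<union> Ls D ` {t+1..horizon D} \<and>
      v3 \<in> {t+1..horizon D} \<rightarrow> {0, 1} \<and> v4 \<in> {t+1..horizon D} \<rightarrow> {0, 1} \<and>
      u3 \<in> {t+1..horizon D} \<rightarrow> {0, 1} \<and> u4 \<in> {t+1..horizon D} \<rightarrow> {0, 1} \<and>
      (\<forall>i\<in>{t+1..horizon D}. v3 i + v4 i + u3 i + u4 i \<le> 1)}"

definition stock_levels :: "stock_data \<Rightarrow> nat \<Rightarrow> real set" where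
  "stock_levels D t = (forward_levels D t \<union> backward_levels D t) \<inter> {Ls D t..Us D t}"

definition max_levels :: "stock_data \<Rightarrow> nat" where
  "max_levels D = Max ((\<lambda>t. card (stock_levels D t)) ` {1..horizon D})"

datatype sense = LE | EQ | GE

fun sense_rel :: "sense \<Rightarrow> real \<Rightarrow> real \<Rightarrow> bool" where
  "sense_rel LE a b \<longleftrightarrow> a \<le> b"
| "sense_rel EQ a b \<longleftrightarrow> a = b"
| "sense_rel GE a b \<longleftrightarrow> a \<ge> b"

text \<open>
  A linear constraint in \<open>(x, y, s, w, z)\<close> and the additional variables
  \<open>u\<^sub>0, \<dots>, u\<^sub>p\<^sub>-\<^sub>1\<close>.
\<close>

record lin_constraint =
  coef_x :: "nat \<Rightarrow> real"
  coef_y :: "nat \<Rightarrow> real"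
  coef_s :: "nat \<Rightarrow> real"
  coef_w :: "nat \<Rightarrow> real"
  coef_z :: "nat \<Rightarrow> real"
  coef_u :: "nat \<Rightarrow> real"
  con_sense :: sense
  con_rhs :: real

fun satisfies :: "nat \<Rightarrow> nat \<Rightarrow> point \<times> (nat \<Rightarrow>\<^sub>0 real) \<Rightarrow> lin_constraint \<Rightarrow> bool" where
  "satisfies T p ((x, y, s, w, z), u) c \<longleftrightarrow>
     sense_rel (con_sense c)
       ((\<Sum>t\<in>{1..T}. coef_x c t * Poly_Mapping.lookup x t + coef_y c t * Poly_Mapping.lookup y t
            + coef_s c t * Poly_Mapping.lookup s t + coef_w c t * Poly_Mapping.lookup w t
            + coef_z c t * Poly_Mapping.lookup z t)
        + (\<Sum>j\<in>{..<p}. coef_u c j * Poly_Mapping.lookup u j))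
       (con_rhs c)"

definition lin_polyhedron ::
  "nat \<Rightarrow> nat \<Rightarrow> lin_constraint list \<Rightarrow> (point \<times> (nat \<Rightarrow>\<^sub>0 real)) set" where
  "lin_polyhedron T p cs =
     {q \<in> point_space T \<times> coord_space {..<p}. \<forall>c\<in>set cs. satisfies T p q c}"

text \<open>
  The formulation has \<open>5 * T + p\<close> variables and \<open>length cs\<close> constraints; every inequality and
  every equation, sign and bound constraints included, has to be listed in \<open>cs\<close>.
\<close>

definition extended_formulation ::
  "nat \<Rightarrow> nat \<Rightarrow> lin_constraint list \<Rightarrow> point set \<Rightarrow> bool" where
  "extended_formulation T p cs P \<longleftrightarrow> fst ` lin_polyhedron T p cs = P"

end

theory Submission
  imports Defs
begin

text \<open>
  Fix the binary variables and the coordinates of \<open>x, y\<close> that vanish at a point of \<open>Q\<^sub>1\<close>. What remains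
  is a polytope in which every vertex has \<open>s\<^sub>t \<in> S\<^sub>t\<close> for all \<open>t\<close>: otherwise the maximal block of
  periods around \<open>t\<close> joined by extreme moves (\<open>x\<^sub>i, y\<^sub>i\<close> at one of their bounds) reaches neither
  \<open>s\<^sub>0\<close> nor a stock bound, and the stock on the whole block can be shifted up and down. Hence \<open>P\<^sub>1\<close>
  is the hull of the points of \<open>Q\<^sub>1\<close> with \<open>s\<^sub>t \<in> S\<^sub>t\<close>. These are the paths in a layered network with
  node set \<open>S\<^sub>t\<close> in layer \<open>t\<close> and at most four parallel arcs (one for each choice of \<open>w\<^sub>t, z\<^sub>t\<close>)
  between two consecutive nodes, and unit flows in this network are the convex combinations of
  paths.
\<close>

section \<open>Vertices of polyhedra and flows in layered networks\<close>

text \<open>Walk along \<open>d\<close> until the first slack constraint becomes tight. Constraints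
  tight at \<open>v\<close> stay tight because \<open>g d = 0\<close>, so strictly fewer are slack
  at the end; this is the descent for an induction over faces.\<close>

lemma move_to_facet:
  fixes J :: "(('v::real_vector \<Rightarrow> real) \<times> real) set"
  assumes fin: "finite J" and lin: "\<And>g c. (g, c) \<in> J \<Longrightarrow> linear g"
    and feas: "\<And>g c. (g, c) \<in> J \<Longrightarrow> c \<le> g v"
    and tight: "\<And>g c. (g, c) \<in> J \<Longrightarrow> g v = c \<Longrightarrow> g d = 0"
    and neg: "\<exists>(g, c)\<in>J. g d < 0"
  obtains \<theta> where "\<theta> > 0" "\<And>g c. (g, c) \<in> J \<Longrightarrow> c \<le> g (v + \<theta> *\<^sub>R d)"
    "{(g, c) \<in> J. g (v + \<theta> *\<^sub>R d) \<noteq> c} \<subset> {(g, c) \<in> J. g v \<noteq> c}"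
proof -
  define N where "N = {(g, c) \<in> J. g d < 0}"
  \<comment> \<open>Ratio test: \<open>\<rho>\<close> is the step length at which a decreasing
    constraint becomes tight.\<close>
  define \<rho> :: "('v \<Rightarrow> real) \<times> real \<Rightarrow> real" where "\<rho> = (\<lambda>(g, c). (g v - c) / - g d)"
  define \<theta> where "\<theta> = Min (\<rho> ` N)"
  have N: "finite N" "N \<noteq> {}"
    using fin neg by (auto simp: N_def intro: finite_subset[of _ J])
  have val: "g (v + \<theta> *\<^sub>R d) = g v + \<theta> * g d" if "(g, c) \<in> J" for g c
    using lin[OF that] by (simp add: linear_add linear_scale)
  have pos: "\<theta> > 0"
  proof -
    have "0 < \<rho> p" if p_N: "p \<in> N" for p
    proof -
      obtain g c where p: "p = (g, c)" "(g, c) \<in> J" "g d < 0"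
        using p_N by (cases p) (auto simp: N_def)
      then have "g v \<noteq> c" using tight by force
      then have "c < g v" using feas[OF p(2)] by simp
      then show ?thesis using p by (simp add: \<rho>_def divide_pos_neg)
    qed
    then show ?thesis using N by (simp add: \<theta>_def)
  qed
  have "c \<le> g (v + \<theta> *\<^sub>R d)" if "(g, c) \<in> J" for g c
  proof (cases "g d < 0")
    case True
    then have "\<theta> \<le> (g v - c) / - g d"
      unfolding \<theta>_def using that N(1)
      by (intro Min_le finite_imageI image_eqI[of _ _ "(g, c)"]) (auto simp: N_def \<rho>_def)
    then show ?thesis using True by (simp add: val[OF that] field_simps)
  next
    case False
    then show ?thesis using feas[OF that] pos by (simp add: val[OF that] add_increasing2)
  qed
  moreover have "{(g, c) \<in> J. g (v + \<theta> *\<^sub>R d) \<noteq> c} \<subset> {(g, c) \<in> J. g v \<noteq> c}"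
  proof -
    have "\<theta> \<in> \<rho> ` N" unfolding \<theta>_def using N by (intro Min_in) auto
    then obtain g c where gc: "(g, c) \<in> J" "g d < 0" "\<theta> = (g v - c) / - g d"
      by (auto simp: N_def \<rho>_def)
    then have "g (v + \<theta> *\<^sub>R d) = c"
      unfolding val[OF gc(1)] by simp
    moreover have "g v \<noteq> c" using gc tight by force
    moreover have "{(g, c) \<in> J. g (v + \<theta> *\<^sub>R d) \<noteq> c} \<subseteq> {(g, c) \<in> J. g v \<noteq> c}"
      by (auto simp: val tight)
    ultimately show ?thesis using gc(1) by blast
  qed
  ultimately show thesis using pos that by blast
qed

text \<open>Minkowski's theorem as an induction principle, on the number of slack constraints. If
  all tight constraints vanish on some nonzero \<open>d\<close> in \<open>W\<close>, then
  \<open>bounded\<close> lets both \<open>d\<close> and \<open>- d\<close> run into a new facet, and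
  \<open>v\<close> lies between the two endpoints. \<open>W\<close> encodes the equations of the
  polyhedron.\<close>

lemma polyhedron_vertex_induct:
  fixes J :: "(('v::real_vector \<Rightarrow> real) \<times> real) set"
  assumes fin: "finite J" and lin: "\<And>g c. (g, c) \<in> J \<Longrightarrow> linear g"
    and sub: "subspace W"
    and bounded: "\<And>d. d \<in> W \<Longrightarrow> d \<noteq> 0 \<Longrightarrow> \<exists>(g, c)\<in>J. g d < 0"
    and conv: "convex C"
    and vertex: "\<And>v. v - v\<^sub>0 \<in> W \<Longrightarrow> (\<And>g c. (g, c) \<in> J \<Longrightarrow> c \<le> g v) \<Longrightarrow>
      (\<And>d. d \<in> W \<Longrightarrow> (\<And>g c. (g, c) \<in> J \<Longrightarrow> g v = c \<Longrightarrow> g d = 0) \<Longrightarrow> d = 0) \<Longrightarrow> v \<in> C"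
    and start: "\<And>g c. (g, c) \<in> J \<Longrightarrow> c \<le> g v\<^sub>0"
  shows "v\<^sub>0 \<in> C"
proof -
  have "v \<in> C" if "v - v\<^sub>0 \<in> W" "\<And>g c. (g, c) \<in> J \<Longrightarrow> c \<le> g v" for v
    using that
  proof (induction "card {(g, c) \<in> J. g v \<noteq> c}" arbitrary: v rule: less_induct)
    case less
    show ?case
    proof (cases "\<exists>d\<in>W. d \<noteq> 0 \<and> (\<forall>(g, c)\<in>J. g v = c \<longrightarrow> g d = 0)")
      case False
      show ?thesis
      proof (rule vertex[OF less.prems(1)])
        show "c \<le> g v" if "(g, c) \<in> J" for g c using less.prems(2)[OF that] .
        show "d = 0" if "d \<in> W" "\<And>g c. (g, c) \<in> J \<Longrightarrow> g v = c \<Longrightarrow> g d = 0" for d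
          using False that by blast
      qed
    next
      case True
      then obtain d where d: "d \<in> W" "d \<noteq> 0"
        and kill: "\<forall>(g, c)\<in>J. g v = c \<longrightarrow> g d = 0"
        by blast
      have step: "\<exists>\<theta>>0. v + \<theta> *\<^sub>R e \<in> C"
        if e: "e \<in> W" "e \<noteq> 0" "\<forall>(g, c)\<in>J. g v = c \<longrightarrow> g e = 0" for e
      proof -
        obtain \<theta> where \<theta>: "\<theta> > 0" "\<And>g c. (g, c) \<in> J \<Longrightarrow> c \<le> g (v + \<theta> *\<^sub>R e)"
          "{(g, c) \<in> J. g (v + \<theta> *\<^sub>R e) \<noteq> c} \<subset> {(g, c) \<in> J. g v \<noteq> c}"
        proof (rule move_to_facet[of J v e])
          show "linear g" if "(g, c) \<in> J" for g c using lin[OF that] .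
          show "c \<le> g v" if "(g, c) \<in> J" for g c using less.prems(2)[OF that] .
          show "g e = 0" if "(g, c) \<in> J" "g v = c" for g c using e(3) that by blast
        qed (use fin bounded[OF e(1,2)] in auto)
        have "finite {(g, c) \<in> J. g v \<noteq> c}" by (rule finite_subset[OF _ fin]) auto
        moreover have "(v - v\<^sub>0) + \<theta> *\<^sub>R e \<in> W"
          using less.prems(1) e(1) sub by (intro subspace_add subspace_scale)
        ultimately have "v + \<theta> *\<^sub>R e \<in> C"
          using less.hyps[of "v + \<theta> *\<^sub>R e"] \<theta> psubset_card_mono[of "{(g, c) \<in> J. g v \<noteq> c}"]
          by (simp add: diff_add_eq)
        then show ?thesis using \<theta>(1) by blast
      qed
      have neg: "- d \<in> W" "- d \<noteq> 0" "\<forall>(g, c)\<in>J. g v = c \<longrightarrow> g (- d) = 0"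
        using d sub subspace_neg kill by (auto simp: linear_neg[OF lin])
      obtain \<alpha> \<beta> where ab: "\<alpha> > 0" "v + \<alpha> *\<^sub>R d \<in> C" "\<beta> > 0" "v + \<beta> *\<^sub>R (- d) \<in> C"
        using step[OF d kill] step[OF neg] by blast
      \<comment> \<open>The step lengths enter crosswise, so that the two multiples of
        \<open>d\<close> cancel.\<close>
      have one: "\<beta> / (\<alpha> + \<beta>) + \<alpha> / (\<alpha> + \<beta>) = 1"
        using ab by (simp flip: add_divide_distrib)
      have "(\<beta> / (\<alpha> + \<beta>)) *\<^sub>R (v + \<alpha> *\<^sub>R d) + (\<alpha> / (\<alpha> + \<beta>)) *\<^sub>R (v + \<beta> *\<^sub>R (- d)) \<in> C"
        using ab one by (intro convexD[OF conv]) auto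
      also have "(\<beta> / (\<alpha> + \<beta>)) *\<^sub>R (v + \<alpha> *\<^sub>R d) + (\<alpha> / (\<alpha> + \<beta>)) *\<^sub>R (v + \<beta> *\<^sub>R (- d))
          = (\<beta> / (\<alpha> + \<beta>) + \<alpha> / (\<alpha> + \<beta>)) *\<^sub>R v"
        by (simp add: algebra_simps)
      finally show ?thesis by (simp add: one)
    qed
  qed
  from this[of v\<^sub>0] show ?thesis using sub start by (simp add: subspace_0)
qed

section \<open>Path decomposition of unit flows\<close>

text \<open>
  A unit flow is the distribution of a Markov chain that leaves each node along an arc chosen with
  probability proportional to the flow; \<open>c e\<close> below is the mean of the path up to \<open>e\<close>, given that
  it uses \<open>e\<close>.
\<close>

lemma flow_in_path_hull:
  fixes w :: "nat \<Rightarrow> 'e \<Rightarrow> 'v::real_vector" and tail head :: "'e \<Rightarrow> 'n"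
  assumes fin: "\<And>t. finite (A t)"
    and pos: "\<And>t e. e \<in> A t \<Longrightarrow> 0 < f t e"
    and conserv: "\<And>t n. 1 \<le> t \<Longrightarrow> t < T \<Longrightarrow>
      sum (f t) {e \<in> A t. head e = n} = sum (f (Suc t)) {e \<in> A (Suc t). tail e = n}"
    and unit: "sum (f 1) (A 1) = 1" and T: "1 \<le> T"
  shows "(\<Sum>t=1..T. \<Sum>e\<in>A t. f t e *\<^sub>R w t e) \<in> convex hull
    {\<Sum>t=1..T. w t (\<pi> t) | \<pi>. (\<forall>t\<in>{1..T}. \<pi> t \<in> A t) \<and>
       (\<forall>t\<in>{1..<T}. head (\<pi> t) = tail (\<pi> (Suc t)))}"
proof -
  define paths where "paths = (\<lambda>t e. {\<Sum>i=1..t. w i (\<pi> i) | \<pi>. (\<forall>i\<in>{1..t}. \<pi> i \<in> A i) \<and>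
       (\<forall>i\<in>{1..<t}. head (\<pi> i) = tail (\<pi> (Suc i))) \<and> \<pi> t = e})"
  \<comment> \<open>Paths ending in the same arc are averaged together, so they can be prolonged arc
    by arc. The last conjunct makes the weights of the final combination add up to 1.\<close>
  have main: "\<exists>c. (\<forall>e\<in>A t. c e \<in> convex hull paths t e) \<and>
      (\<Sum>e\<in>A t. f t e *\<^sub>R c e) = (\<Sum>i=1..t. \<Sum>e\<in>A i. f i e *\<^sub>R w i e) \<and> sum (f t) (A t) = 1"
    if "1 \<le> t" "t \<le> T" for t
    using that
  proof (induction t rule: dec_induct)
    case base
    have "w 1 e \<in> paths 1 e" if "e \<in> A 1" for e
      unfolding paths_def using that by (intro CollectI exI[of _ "\<lambda>_. e"]) auto
    then show ?case
      using unit by (intro exI[of _ "w 1"]) (auto intro: hull_inc)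
  next
    case (step t)
    then obtain c where c: "\<And>e. e \<in> A t \<Longrightarrow> c e \<in> convex hull paths t e"
      and sum_c: "(\<Sum>e\<in>A t. f t e *\<^sub>R c e) = (\<Sum>i=1..t. \<Sum>e\<in>A i. f i e *\<^sub>R w i e)"
      and tot: "sum (f t) (A t) = 1"
      by auto
    define I where "I = (\<lambda>n. {e \<in> A t. head e = n})"
    define O' where "O' = (\<lambda>n. {e \<in> A (Suc t). tail e = n})"
    define g where "g = (\<lambda>n. sum (f t) (I n))"
    have g_O: "g n = sum (f (Suc t)) (O' n)" for n
      unfolding g_def I_def O'_def using step by (intro conserv) auto
    have fin_IO: "finite (I n)" "finite (O' n)" for n
      using fin by (auto simp: I_def O'_def)
    have g_pos: "0 < g (tail e)" if "e \<in> A (Suc t)" for e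
      unfolding g_O using that pos by (intro sum_pos fin_IO) (auto simp: O'_def)
    \<comment> \<open>Every arc of \<open>A t\<close> carries positive flow, so a node without
      throughput has no incoming arc; this settles the division by \<open>g n = 0\<close> further
      down.\<close>
    have I_empty: "I n = {}" if "g n = 0" for n
      using that pos sum_pos[OF fin_IO(1), of n "f t"] by (force simp: g_def I_def)
    define c' where "c' = (\<lambda>e. w (Suc t) e + (\<Sum>e'\<in>I (tail e). (f t e' / g (tail e)) *\<^sub>R c e'))"
    have "c' e \<in> convex hull paths (Suc t) e" if e: "e \<in> A (Suc t)" for e
    proof -
      have "(\<Sum>e'\<in>I (tail e). (f t e' / g (tail e)) *\<^sub>R c e')
          \<in> convex hull (\<Union>e'\<in>I (tail e). paths t e')"
      proof (rule convex_sum[OF fin_IO(1) convex_convex_hull])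
        show "(\<Sum>e'\<in>I (tail e). f t e' / g (tail e)) = 1"
          using g_pos[OF e] by (simp flip: sum_divide_distrib add: g_def)
        show "0 \<le> f t e' / g (tail e)" if "e' \<in> I (tail e)" for e'
          using that pos g_pos[OF e] by (simp add: I_def less_imp_le)
        show "c e' \<in> convex hull (\<Union>e'\<in>I (tail e). paths t e')" if "e' \<in> I (tail e)" for e'
          using c[of e'] that hull_mono[of "paths t e'" "\<Union>e'\<in>I (tail e). paths t e'" convex]
          by (auto simp: I_def)
      qed
      \<comment> \<open>Appending \<open>e\<close> translates all paths by the same vector, and
        hulls commute with translations.\<close>
      then have "c' e \<in> convex hull ((+) (w (Suc t) e) ` (\<Union>e'\<in>I (tail e). paths t e'))"
        unfolding c'_def convex_hull_translation by (rule imageI)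
      moreover have "(+) (w (Suc t) e) ` (\<Union>e'\<in>I (tail e). paths t e') \<subseteq> paths (Suc t) e"
      proof clarify
        fix e' v assume e': "e' \<in> I (tail e)" and "v \<in> paths t e'"
        then obtain \<pi> where \<pi>: "v = (\<Sum>i=1..t. w i (\<pi> i))" "\<forall>i\<in>{1..t}. \<pi> i \<in> A i"
          "\<forall>i\<in>{1..<t}. head (\<pi> i) = tail (\<pi> (Suc i))" "\<pi> t = e'"
          by (auto simp: paths_def)
        have "w (Suc t) e + v = (\<Sum>i=1..Suc t. w i ((\<pi>(Suc t := e)) i))"
          by (simp add: \<pi>(1))
        then show "w (Suc t) e + v \<in> paths (Suc t) e"
          unfolding paths_def using \<pi>(2-4) e e'
          by (intro CollectI exI[of _ "\<pi>(Suc t := e)"]) (auto simp: I_def le_Suc_eq less_Suc_eq)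
      qed
      ultimately show ?thesis using hull_mono by blast
    qed
    moreover have "(\<Sum>e\<in>A (Suc t). f (Suc t) e *\<^sub>R c' e)
        = (\<Sum>i=1..Suc t. \<Sum>e\<in>A i. f i e *\<^sub>R w i e)"
    proof -
      \<comment> \<open>All nodes between the two layers; sums over the arcs on either side are
        regrouped by node, where conservation applies.\<close>
      define M where "M = head ` A t \<union> tail ` A (Suc t)"
      have finM: "finite M" using fin by (simp add: M_def)
      have "(\<Sum>e\<in>A (Suc t). f (Suc t) e *\<^sub>R (\<Sum>e'\<in>I (tail e). (f t e' / g (tail e)) *\<^sub>R c e'))
          = (\<Sum>n\<in>M. \<Sum>e\<in>O' n. f (Suc t) e *\<^sub>R (\<Sum>e'\<in>I n. (f t e' / g n) *\<^sub>R c e'))"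
        unfolding O'_def by (subst sum.group[symmetric, OF fin finM, of tail]) (auto simp: M_def)
      also have "\<dots> = (\<Sum>n\<in>M. g n *\<^sub>R (\<Sum>e'\<in>I n. (f t e' / g n) *\<^sub>R c e'))"
        by (simp add: g_O scaleR_left.sum)
      also have "\<dots> = (\<Sum>n\<in>M. \<Sum>e'\<in>I n. f t e' *\<^sub>R c e')"
      proof (rule sum.cong[OF refl])
        fix n show "g n *\<^sub>R (\<Sum>e'\<in>I n. (f t e' / g n) *\<^sub>R c e') = (\<Sum>e'\<in>I n. f t e' *\<^sub>R c e')"
          by (cases "g n = 0") (auto simp: I_empty scaleR_sum_right)
      qed
      also have "\<dots> = (\<Sum>e'\<in>A t. f t e' *\<^sub>R c e')"
        unfolding I_def by (subst sum.group[OF fin finM]) (auto simp: M_def)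
      finally show ?thesis
        by (simp add: c'_def scaleR_add_right sum.distrib sum_c add.commute)
    qed
    moreover have "sum (f (Suc t)) (A (Suc t)) = 1"
    proof -
      define M where "M = head ` A t \<union> tail ` A (Suc t)"
      have finM: "finite M" using fin by (simp add: M_def)
      have "sum (f (Suc t)) (A (Suc t)) = (\<Sum>n\<in>M. sum (f (Suc t)) (O' n))"
        unfolding O'_def by (subst sum.group[OF fin finM]) (auto simp: M_def)
      also have "\<dots> = (\<Sum>n\<in>M. sum (f t) (I n))" by (simp flip: g_O add: g_def)
      also have "\<dots> = sum (f t) (A t)"
        unfolding I_def by (subst sum.group[OF fin finM]) (auto simp: M_def)
      finally show ?thesis using tot by simp
    qed
    ultimately show ?case by (intro exI[of _ c']) auto
  qed
  obtain c where c: "\<And>e. e \<in> A T \<Longrightarrow> c e \<in> convex hull paths T e"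
    and sum_c: "(\<Sum>e\<in>A T. f T e *\<^sub>R c e) = (\<Sum>i=1..T. \<Sum>e\<in>A i. f i e *\<^sub>R w i e)"
    and tot: "sum (f T) (A T) = 1"
    using main[of T] T by blast
  let ?P = "{\<Sum>t=1..T. w t (\<pi> t) | \<pi>. (\<forall>t\<in>{1..T}. \<pi> t \<in> A t) \<and>
       (\<forall>t\<in>{1..<T}. head (\<pi> t) = tail (\<pi> (Suc t)))}"
  have "c e \<in> convex hull ?P" if "e \<in> A T" for e
    using c[OF that] hull_mono[of "paths T e" ?P convex] by (auto simp: paths_def)
  then have "(\<Sum>e\<in>A T. f T e *\<^sub>R c e) \<in> convex hull ?P"
    using tot pos by (intro convex_sum fin convex_convex_hull) (auto intro: less_imp_le)
  then show ?thesis by (simp add: sum_c)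
qed

section \<open>Coordinates and linear encodings\<close>

lemma lookup_scaleR [simp]:
  "Poly_Mapping.lookup (r *\<^sub>R f) i = r *\<^sub>R Poly_Mapping.lookup f i"
  for f :: "'a \<Rightarrow>\<^sub>0 'b::real_vector"
proof -
  have "finite {i. r *\<^sub>R Poly_Mapping.lookup f i \<noteq> 0}"
    by (rule finite_subset[OF _ finite_keys[of f]]) (auto simp: in_keys_iff)
  then show ?thesis by (simp add: scaleR_poly_mapping_def)
qed

definition "x_val (p::point) = Poly_Mapping.lookup (fst p)"
definition "y_val (p::point) = Poly_Mapping.lookup (fst (snd p))"
definition "s_val (p::point) = Poly_Mapping.lookup (fst (snd (snd p)))"
definition "w_val (p::point) = Poly_Mapping.lookup (fst (snd (snd (snd p))))"
definition "z_val (p::point) = Poly_Mapping.lookup (snd (snd (snd (snd p))))"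

lemmas val_defs = x_val_def y_val_def s_val_def w_val_def z_val_def

lemma val_add [simp]:
  "x_val (p + q) t = x_val p t + x_val q t" "y_val (p + q) t = y_val p t + y_val q t"
  "s_val (p + q) t = s_val p t + s_val q t" "w_val (p + q) t = w_val p t + w_val q t"
  "z_val (p + q) t = z_val p t + z_val q t"
  by (simp_all add: val_defs lookup_add)

lemma val_diff [simp]:
  "x_val (p - q) t = x_val p t - x_val q t" "y_val (p - q) t = y_val p t - y_val q t"
  "s_val (p - q) t = s_val p t - s_val q t" "w_val (p - q) t = w_val p t - w_val q t"
  "z_val (p - q) t = z_val p t - z_val q t"
  by (simp_all add: val_defs lookup_minus)

lemma val_scaleR [simp]:
  "x_val (r *\<^sub>R p) t = r * x_val p t" "y_val (r *\<^sub>R p) t = r * y_val p t"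
  "s_val (r *\<^sub>R p) t = r * s_val p t" "w_val (r *\<^sub>R p) t = r * w_val p t"
  "z_val (r *\<^sub>R p) t = r * z_val p t"
  by (simp_all add: val_defs)

lemma val_zero [simp]:
  "x_val 0 t = 0" "y_val 0 t = 0" "s_val 0 t = 0" "w_val 0 t = 0" "z_val 0 t = 0"
  by (simp_all add: val_defs)

lemma val_sum [simp]:
  "x_val (sum f A) t = (\<Sum>a\<in>A. x_val (f a) t)" "y_val (sum f A) t = (\<Sum>a\<in>A. y_val (f a) t)"
  "s_val (sum f A) t = (\<Sum>a\<in>A. s_val (f a) t)" "w_val (sum f A) t = (\<Sum>a\<in>A. w_val (f a) t)"
  "z_val (sum f A) t = (\<Sum>a\<in>A. z_val (f a) t)"
  by (induction A rule: infinite_finite_induct; simp)+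

lemma linear_val:
  "linear (\<lambda>p. x_val p t)" "linear (\<lambda>p. y_val p t)" "linear (\<lambda>p. s_val p t)"
  "linear (\<lambda>p. w_val p t)" "linear (\<lambda>p. z_val p t)"
  by (rule linearI; simp only: val_add val_scaleR real_scaleR_def)+

lemma coord_space_iff: "f \<in> coord_space I \<longleftrightarrow> (\<forall>i. i \<notin> I \<longrightarrow> Poly_Mapping.lookup f i = 0)"
  by (auto simp: coord_space_def in_keys_iff)

lemma subspace_coord_space: "subspace (coord_space I)"
  by (auto simp: subspace_def coord_space_iff lookup_add)

lemma subspace_point_space: "subspace (point_space T)"
  unfolding point_space_def by (intro subspace_Times subspace_coord_space)

lemma point_space_iff:
  "p \<in> point_space T \<longleftrightarrow> (\<forall>t. t \<notin> {1..T} \<longrightarrow>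
     x_val p t = 0 \<and> y_val p t = 0 \<and> s_val p t = 0 \<and> w_val p t = 0 \<and> z_val p t = 0)"
  by (cases p) (auto simp: point_space_def coord_space_iff val_defs)

lemma point_eqI:
  assumes "p \<in> point_space T" "q \<in> point_space T"
    and "\<And>t. t \<in> {1..T} \<Longrightarrow> x_val p t = x_val q t" "\<And>t. t \<in> {1..T} \<Longrightarrow> y_val p t = y_val q t"
      "\<And>t. t \<in> {1..T} \<Longrightarrow> s_val p t = s_val q t" "\<And>t. t \<in> {1..T} \<Longrightarrow> w_val p t = w_val q t"
      "\<And>t. t \<in> {1..T} \<Longrightarrow> z_val p t = z_val q t"
  shows "p = q"
proof -
  have "x_val p t = x_val q t \<and> y_val p t = y_val q t \<and> s_val p t = s_val q t \<and>
      w_val p t = w_val q t \<and> z_val p t = z_val q t" for t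
  proof (cases "t \<in> {1..T}")
    case True
    then show ?thesis by (intro conjI assms(3-7))
  next
    case False
    then show ?thesis using assms(1,2) unfolding point_space_iff by metis
  qed
  then have "x_val p = x_val q" "y_val p = y_val q" "s_val p = s_val q" "w_val p = w_val q"
    "z_val p = z_val q"
    by (intro ext; simp)+
  then show ?thesis by (simp add: val_defs prod_eq_iff poly_mapping_eqI)
qed

text \<open>The five coordinate families are kept apart to match the five blocks of equations in the
  formulation below.\<close>

lemma point_eq_iff:
  assumes "p \<in> point_space T" "q \<in> point_space T"
  shows "p = q \<longleftrightarrow> (\<forall>t\<in>{1..T}. x_val p t = x_val q t) \<and> (\<forall>t\<in>{1..T}. y_val p t = y_val q t)
    \<and> (\<forall>t\<in>{1..T}. s_val p t = s_val q t) \<and> (\<forall>t\<in>{1..T}. w_val p t = w_val q t)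
    \<and> (\<forall>t\<in>{1..T}. z_val p t = z_val q t)" (is "_ \<longleftrightarrow> ?R")
proof
  assume ?R
  then show "p = q" by (intro point_eqI[OF assms]) (elim conjE, erule (1) bspec)+
qed simp

definition unit_point :: "nat \<Rightarrow> real \<Rightarrow> real \<Rightarrow> real \<Rightarrow> real \<Rightarrow> real \<Rightarrow> point" where
  "unit_point t a b c d e = (Poly_Mapping.single t a, Poly_Mapping.single t b,
     Poly_Mapping.single t c, Poly_Mapping.single t d, Poly_Mapping.single t e)"

lemma val_unit_point [simp]:
  "x_val (unit_point t a b c d e) i = (if i = t then a else 0)"
  "y_val (unit_point t a b c d e) i = (if i = t then b else 0)"
  "s_val (unit_point t a b c d e) i = (if i = t then c else 0)"
  "w_val (unit_point t a b c d e) i = (if i = t then d else 0)"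
  "z_val (unit_point t a b c d e) i = (if i = t then e else 0)"
  by (auto simp: unit_point_def val_defs lookup_single when_def)

lemma unit_point_in_point_space: "t \<in> {1..T} \<Longrightarrow> unit_point t a b c d e \<in> point_space T"
  by (auto simp: point_space_iff)

section \<open>From weighted sums to an extended formulation\<close>

text \<open>The weights themselves serve as additional variables; projecting them away leaves the
  weighted sums.\<close>

lemma extended_formulation_of_weights:
  fixes W :: "'e \<Rightarrow> point" and h :: "'k \<Rightarrow> 'e \<Rightarrow> real"
  assumes E: "finite E" and K: "finite K" and W: "\<And>e. e \<in> E \<Longrightarrow> W e \<in> point_space T"
  shows "\<exists>cs. length cs = card E + card K + 5 * T \<and> extended_formulation T (card E) cs
    {\<Sum>e\<in>E. f e *\<^sub>R W e | f. (\<forall>e\<in>E. 0 \<le> f e) \<and> (\<forall>k\<in>K. (\<Sum>e\<in>E. h k e * f e) = r k)}"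
proof -
  let ?p = "card E"
  let ?F = "{\<Sum>e\<in>E. f e *\<^sub>R W e | f. (\<forall>e\<in>E. 0 \<le> f e) \<and> (\<forall>k\<in>K. (\<Sum>e\<in>E. h k e * f e) = r k)}"
  \<comment> \<open>Additional variables are numbered, so \<open>E\<close> is enumerated: variable
    \<open>j\<close> is the weight of \<open>\<phi> j\<close>.\<close>
  obtain \<phi> where \<phi>: "bij_betw \<phi> {..<?p} E"
    using ex_bij_betw_nat_finite[OF E] by (auto simp: atLeast0LessThan)
  obtain ks where ks: "set ks = K" "length ks = card K"
    using finite_distinct_list[OF K] distinct_card by metis
  define \<delta> :: "nat \<Rightarrow> nat \<Rightarrow> real" where "\<delta> = (\<lambda>t i. of_bool (i = t))"
  define con where "con = (\<lambda>a b c d e u sn rh. \<lparr>coef_x = a, coef_y = b, coef_s = c, coef_w = d,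
    coef_z = e, coef_u = u, con_sense = sn, con_rhs = rh\<rparr>)"
  define o' :: "nat \<Rightarrow> real" where "o' = (\<lambda>_. 0)"
  \<comment> \<open>First the signs of the weights, then the equations indexed by \<open>K\<close>,
    then for each coordinate family \<open>T\<close> equations that fix the point as the weighted
    sum.\<close>
  define cs where "cs =
     map (\<lambda>j. con o' o' o' o' o' (\<delta> j) GE 0) [0..<?p]
   @ map (\<lambda>k. con o' o' o' o' o' (\<lambda>j. h k (\<phi> j)) EQ (r k)) ks
   @ map (\<lambda>t. con (\<delta> t) o' o' o' o' (\<lambda>j. - x_val (W (\<phi> j)) t) EQ 0) [1..<Suc T]
   @ map (\<lambda>t. con o' (\<delta> t) o' o' o' (\<lambda>j. - y_val (W (\<phi> j)) t) EQ 0) [1..<Suc T]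
   @ map (\<lambda>t. con o' o' (\<delta> t) o' o' (\<lambda>j. - s_val (W (\<phi> j)) t) EQ 0) [1..<Suc T]
   @ map (\<lambda>t. con o' o' o' (\<delta> t) o' (\<lambda>j. - w_val (W (\<phi> j)) t) EQ 0) [1..<Suc T]
   @ map (\<lambda>t. con o' o' o' o' (\<delta> t) (\<lambda>j. - z_val (W (\<phi> j)) t) EQ 0) [1..<Suc T]"
  have sat: "satisfies T ?p (q, u) (con a b c d e v sn rh) \<longleftrightarrow> sense_rel sn
      ((\<Sum>t=1..T. a t * x_val q t) + (\<Sum>t=1..T. b t * y_val q t) + (\<Sum>t=1..T. c t * s_val q t)
       + (\<Sum>t=1..T. d t * w_val q t) + (\<Sum>t=1..T. e t * z_val q t)
       + (\<Sum>j<?p. v j * Poly_Mapping.lookup u j)) rh" for q u a b c d e v sn rh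
    by (cases q) (simp add: con_def val_defs sum.distrib)
  have \<delta>_sum: "(\<Sum>i\<in>A. \<delta> t i * g i) = (if t \<in> A then g t else 0)" if "finite A" for t A and g :: "nat \<Rightarrow> real"
    using that by (simp add: \<delta>_def of_bool_def if_distrib[of "\<lambda>x. x * _"] cong: if_cong)
  have iff: "(q, u) \<in> lin_polyhedron T ?p cs \<longleftrightarrow> q \<in> point_space T \<and> u \<in> coord_space {..<?p} \<and>
      (\<forall>j\<in>{..<?p}. 0 \<le> Poly_Mapping.lookup u j) \<and>
      (\<forall>k\<in>K. (\<Sum>j<?p. h k (\<phi> j) * Poly_Mapping.lookup u j) = r k) \<and>
      q = (\<Sum>j<?p. Poly_Mapping.lookup u j *\<^sub>R W (\<phi> j))" (is "_ \<longleftrightarrow> ?R") for q u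
  proof -
    let ?q = "\<Sum>j<?p. Poly_Mapping.lookup u j *\<^sub>R W (\<phi> j)"
    have in_E: "\<phi> j \<in> E" if "j < ?p" for j
      using \<phi> that by (auto simp: bij_betw_def)
    then have q': "?q \<in> point_space T"
      by (intro subspace_sum[OF subspace_point_space] subspace_scale[OF subspace_point_space] W) auto
    have eq: "q = ?q \<longleftrightarrow> (\<forall>t\<in>{1..T}. x_val q t = x_val ?q t) \<and> (\<forall>t\<in>{1..T}. y_val q t = y_val ?q t)
      \<and> (\<forall>t\<in>{1..T}. s_val q t = s_val ?q t) \<and> (\<forall>t\<in>{1..T}. w_val q t = w_val ?q t)
      \<and> (\<forall>t\<in>{1..T}. z_val q t = z_val ?q t)" if "q \<in> point_space T"
      by (rule point_eq_iff[OF that q'])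
    have "(q, u) \<in> lin_polyhedron T ?p cs \<longleftrightarrow> q \<in> point_space T \<and> u \<in> coord_space {..<?p} \<and>
      (\<forall>j\<in>{..<?p}. 0 \<le> Poly_Mapping.lookup u j) \<and>
      (\<forall>k\<in>K. (\<Sum>j<?p. h k (\<phi> j) * Poly_Mapping.lookup u j) = r k) \<and>
      ((\<forall>t\<in>{1..T}. x_val q t = x_val ?q t) \<and> (\<forall>t\<in>{1..T}. y_val q t = y_val ?q t)
      \<and> (\<forall>t\<in>{1..T}. s_val q t = s_val ?q t) \<and> (\<forall>t\<in>{1..T}. w_val q t = w_val ?q t)
      \<and> (\<forall>t\<in>{1..T}. z_val q t = z_val ?q t))"
      unfolding lin_polyhedron_def cs_def set_append set_map ball_Un ball_simps sat mem_Collect_eq mem_Times_iff fst_conv snd_conv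
      by (simp add: ks(1) o'_def \<delta>_sum sum_negf atLeastLessThanSuc_atLeastAtMost atLeast0LessThan
          mult.commute[of "x_val _ _"] mult.commute[of "y_val _ _"] mult.commute[of "s_val _ _"]
          mult.commute[of "w_val _ _"] mult.commute[of "z_val _ _"] del: upt_Suc cong: conj_cong)
    then show ?thesis using eq by blast
  qed
  have "fst ` lin_polyhedron T ?p cs = ?F"
  proof (intro equalityI subsetI)
    fix q assume "q \<in> fst ` lin_polyhedron T ?p cs"
    then obtain u where u: "(q, u) \<in> lin_polyhedron T ?p cs" by force
    define f where "f = (\<lambda>e. Poly_Mapping.lookup u (the_inv_into {..<?p} \<phi> e))"
    have f: "f (\<phi> j) = Poly_Mapping.lookup u j" if "j < ?p" for j
      using \<phi> that by (simp add: f_def bij_betw_def the_inv_into_f_f)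
    have img: "\<phi> ` {..<?p} = E" using \<phi> by (simp add: bij_betw_def)
    have h_sum: "(\<Sum>e\<in>E. h k e * f e) = (\<Sum>j<?p. h k (\<phi> j) * Poly_Mapping.lookup u j)" for k
      using f by (simp flip: sum.reindex_bij_betw[OF \<phi>])
    have W_sum: "(\<Sum>e\<in>E. f e *\<^sub>R W e) = (\<Sum>j<?p. Poly_Mapping.lookup u j *\<^sub>R W (\<phi> j))"
      using f by (simp flip: sum.reindex_bij_betw[OF \<phi>])
    have "\<forall>e\<in>\<phi> ` {..<?p}. 0 \<le> f e"
      using u f unfolding iff by simp
    then have "\<forall>e\<in>E. 0 \<le> f e" unfolding img .
    moreover have "\<forall>k\<in>K. (\<Sum>e\<in>E. h k e * f e) = r k"
      using u unfolding iff h_sum by simp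
    moreover have "q = (\<Sum>e\<in>E. f e *\<^sub>R W e)"
      using u unfolding iff W_sum by (elim conjE)
    ultimately show "q \<in> ?F" by blast
  next
    fix q assume "q \<in> ?F"
    then obtain f where f: "q = (\<Sum>e\<in>E. f e *\<^sub>R W e)" "\<forall>e\<in>E. 0 \<le> f e"
      "\<forall>k\<in>K. (\<Sum>e\<in>E. h k e * f e) = r k" by blast
    define u where "u = (\<Sum>j<?p. Poly_Mapping.single j (f (\<phi> j)))"
    have u: "Poly_Mapping.lookup u j = (if j < ?p then f (\<phi> j) else 0)" for j
      by (simp add: u_def lookup_sum lookup_single when_def)
    have "q \<in> point_space T"
      unfolding f(1)
      by (intro subspace_sum[OF subspace_point_space] subspace_scale[OF subspace_point_space] W)
    moreover have "u \<in> coord_space {..<?p}" by (simp add: coord_space_iff u)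
    moreover have "\<forall>j\<in>{..<?p}. 0 \<le> Poly_Mapping.lookup u j"
      using f(2) \<phi> by (auto simp: u bij_betw_def)
    moreover have "\<forall>k\<in>K. (\<Sum>j<?p. h k (\<phi> j) * Poly_Mapping.lookup u j) = r k"
      using f(3) by (simp add: u flip: sum.reindex_bij_betw[OF \<phi>])
    moreover have "q = (\<Sum>j<?p. Poly_Mapping.lookup u j *\<^sub>R W (\<phi> j))"
      by (simp add: f(1) u flip: sum.reindex_bij_betw[OF \<phi>])
    ultimately have "(q, u) \<in> lin_polyhedron T ?p cs" by (simp add: iff)
    then show "q \<in> fst ` lin_polyhedron T ?p cs" by force
  qed
  moreover have "length cs = card E + card K + 5 * T"
    by (simp add: cs_def ks(2))
  ultimately show ?thesis unfolding extended_formulation_def by blast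
qed

section \<open>Stock levels of vertices\<close>

text \<open>Only the values of the selectors on \<open>I\<close> matter, so they can be drawn from
  finitely many extensional functions.\<close>

lemma finite_choice_sums:
  fixes a b :: "nat \<Rightarrow> real"
  assumes "finite I"
  shows "finite {\<Sum>i\<in>I. v i * a i + v' i * b i | v v'. v \<in> I \<rightarrow> {0, 1} \<and> v' \<in> I \<rightarrow> {0, 1}}"
proof -
  let ?B = "I \<rightarrow>\<^sub>E {0, 1::real}"
  have "(\<Sum>i\<in>I. v i * a i + v' i * b i) \<in> (\<lambda>(v, v'). \<Sum>i\<in>I. v i * a i + v' i * b i) ` (?B \<times> ?B)"
    if "v \<in> I \<rightarrow> {0, 1}" "v' \<in> I \<rightarrow> {0, 1}" for v v'
    using that by (intro image_eqI[of _ _ "(restrict v I, restrict v' I)"]) auto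
  then have "{\<Sum>i\<in>I. v i * a i + v' i * b i | v v'. v \<in> I \<rightarrow> {0, 1} \<and> v' \<in> I \<rightarrow> {0, 1}}
      \<subseteq> (\<lambda>(v, v'). \<Sum>i\<in>I. v i * a i + v' i * b i) ` (?B \<times> ?B)"
    by blast
  moreover have "finite (?B \<times> ?B)"
    using assms by (intro finite_cartesian_product finite_PiE) auto
  ultimately show ?thesis by (rule finite_subset[OF _ finite_imageI])
qed

text \<open>Dropping the condition that at most one selector is 1 gives a superset that is the image
  of a finite product. Finiteness matters because \<open>card\<close> of an infinite set is
  0.\<close>

lemma finite_forward_levels: "finite (forward_levels D t)"
proof -
  let ?K = "{init_stock D} \<union> Us D ` {1..t} \<union> Ls D ` {1..t}"
  let ?P = "\<lambda>a b. {\<Sum>i\<in>{1..t}. v i * a i + v' i * b i | v v'.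
    v \<in> {1..t} \<rightarrow> {0, 1} \<and> v' \<in> {1..t} \<rightarrow> {0, 1::real}}"
  have "forward_levels D t \<subseteq> (\<lambda>(k, p, q). k - p + q) ` (?K \<times> ?P (Ly D) (Uy D) \<times> ?P (Lx D) (Ux D))"
  proof
    fix r assume "r \<in> forward_levels D t"
    then obtain k v1 v2 u1 u2 where
      "r = k - (\<Sum>i\<in>{1..t}. v1 i * Ly D i + v2 i * Uy D i)
         + (\<Sum>i\<in>{1..t}. u1 i * Lx D i + u2 i * Ux D i)" "k \<in> ?K"
      "v1 \<in> {1..t} \<rightarrow> {0, 1}" "v2 \<in> {1..t} \<rightarrow> {0, 1}" "u1 \<in> {1..t} \<rightarrow> {0, 1}" "u2 \<in> {1..t} \<rightarrow> {0, 1}"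
      unfolding forward_levels_def by blast
    then show "r \<in> (\<lambda>(k, p, q). k - p + q) ` (?K \<times> ?P (Ly D) (Uy D) \<times> ?P (Lx D) (Ux D))"
      by (intro image_eqI[of _ _ "(k, \<Sum>i\<in>{1..t}. v1 i * Ly D i + v2 i * Uy D i,
         \<Sum>i\<in>{1..t}. u1 i * Lx D i + u2 i * Ux D i)"]) (simp only: prod.case, intro SigmaI, blast+)
  qed
  then show ?thesis
    by (rule finite_subset) (intro finite_imageI finite_cartesian_product finite_choice_sums, auto)
qed

lemma finite_backward_levels: "finite (backward_levels D t)"
proof -
  let ?I = "{t + 1..horizon D}"
  let ?K = "Us D ` ?I \<union> Ls D ` ?I"
  let ?P = "\<lambda>a b. {\<Sum>i\<in>?I. v i * a i + v' i * b i | v v'.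
    v \<in> ?I \<rightarrow> {0, 1} \<and> v' \<in> ?I \<rightarrow> {0, 1::real}}"
  have "backward_levels D t \<subseteq> (\<lambda>(k, p, q). k + p - q) ` (?K \<times> ?P (Ly D) (Uy D) \<times> ?P (Lx D) (Ux D))"
  proof
    fix r assume "r \<in> backward_levels D t"
    then obtain k v1 v2 u1 u2 where
      "r = k + (\<Sum>i\<in>?I. v1 i * Ly D i + v2 i * Uy D i)
         - (\<Sum>i\<in>?I. u1 i * Lx D i + u2 i * Ux D i)" "k \<in> ?K"
      "v1 \<in> ?I \<rightarrow> {0, 1}" "v2 \<in> ?I \<rightarrow> {0, 1}" "u1 \<in> ?I \<rightarrow> {0, 1}" "u2 \<in> ?I \<rightarrow> {0, 1}"
      unfolding backward_levels_def by blast
    then show "r \<in> (\<lambda>(k, p, q). k + p - q) ` (?K \<times> ?P (Ly D) (Uy D) \<times> ?P (Lx D) (Ux D))"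
      by (intro image_eqI[of _ _ "(k, \<Sum>i\<in>?I. v1 i * Ly D i + v2 i * Uy D i,
         \<Sum>i\<in>?I. u1 i * Lx D i + u2 i * Ux D i)"]) (simp only: prod.case, intro SigmaI, blast+)
  qed
  then show ?thesis
    by (rule finite_subset) (intro finite_imageI finite_cartesian_product finite_choice_sums, auto)
qed

lemma finite_stock_levels: "finite (stock_levels D t)"
  unfolding stock_levels_def by (intro finite_Int disjI1 finite_UnI finite_forward_levels finite_backward_levels)

section \<open>Levels reached by extreme moves\<close>

text \<open>\<open>u\<close>, \<open>u'\<close> select the bounds on \<open>x\<^sub>i\<close> and \<open>v\<close>, \<open>v'\<close> those on \<open>y\<^sub>i\<close>.\<close>

definition extreme_move ::
  "stock_data \<Rightarrow> nat \<Rightarrow> real \<Rightarrow> real \<Rightarrow> real \<Rightarrow> real \<Rightarrow> real \<Rightarrow> bool" where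
  "extreme_move D i v v' u u' \<delta> \<longleftrightarrow> v \<in> {0, 1} \<and> v' \<in> {0, 1} \<and> u \<in> {0, 1} \<and> u' \<in> {0, 1} \<and>
     v + v' + u + u' \<le> 1 \<and> \<delta> = (u * Lx D i + u' * Ux D i) - (v * Ly D i + v' * Uy D i)"

lemma extreme_move_0: "extreme_move D i 0 0 0 0 0"
  by (simp add: extreme_move_def)

text \<open>\<open>\<sigma>\<close> is a stock trajectory that is at a known level in period
  \<open>k\<close>; its moves from there to \<open>t\<close> telescope. The case
  \<open>k = 0\<close> covers the initial stock.\<close>

lemma forward_levelsI:
  assumes "k \<le> t" and K: "\<sigma> k \<in> {init_stock D} \<union> Us D ` {1..t} \<union> Ls D ` {1..t}"
    and move: "\<And>i. k < i \<Longrightarrow> i \<le> t \<Longrightarrow> \<exists>v v' u u'. extreme_move D i v v' u u' (\<sigma> i - \<sigma> (i - 1))"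
  shows "\<sigma> t \<in> forward_levels D t"
proof -
  \<comment> \<open>The level set sums over all periods from 1, so periods up to \<open>k\<close>
    receive the zero move.\<close>
  define \<delta> where "\<delta> = (\<lambda>i. if k < i then \<sigma> i - \<sigma> (i - 1) else 0)"
  have "\<forall>i\<in>{1..t}. \<exists>v v' u u'. extreme_move D i v v' u u' (\<delta> i)"
    using move extreme_move_0 by (fastforce simp: \<delta>_def)
  then obtain v v' u u' where m: "\<forall>i\<in>{1..t}. extreme_move D i (v i) (v' i) (u i) (u' i) (\<delta> i)"
    by metis
  have "\<sigma> t - \<sigma> k = (\<Sum>i\<in>{Suc k..t}. \<sigma> i - \<sigma> (i - 1))"
    using sum_telescope''[OF \<open>k \<le> t\<close>, of \<sigma>] by simp
  also have "\<dots> = (\<Sum>i\<in>{1..t}. \<delta> i)"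
    by (rule sum.mono_neutral_cong_left) (auto simp: \<delta>_def)
  also have "\<dots> = (\<Sum>i\<in>{1..t}. (u i * Lx D i + u' i * Ux D i) - (v i * Ly D i + v' i * Uy D i))"
    using m by (intro sum.cong) (auto simp: extreme_move_def)
  finally have "\<sigma> t = \<sigma> k - (\<Sum>i\<in>{1..t}. v i * Ly D i + v' i * Uy D i)
      + (\<Sum>i\<in>{1..t}. u i * Lx D i + u' i * Ux D i)"
    by (simp add: sum_subtractf)
  then show ?thesis
    unfolding forward_levels_def mem_Collect_eq using K m
    by (intro exI[of _ "\<sigma> k"] exI[of _ v] exI[of _ v'] exI[of _ u] exI[of _ u'])
      (simp add: extreme_move_def Pi_iff)
qed

text \<open>The same telescoping, undone from a later period \<open>k\<close>, hence the opposite
  signs; here the periods after \<open>k\<close> receive the zero move.\<close>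

lemma backward_levelsI:
  assumes k: "t < k" "k \<le> horizon D"
    and K: "\<sigma> k \<in> Us D ` {t+1..horizon D} \<union> Ls D ` {t+1..horizon D}"
    and move: "\<And>i. t < i \<Longrightarrow> i \<le> k \<Longrightarrow> \<exists>v v' u u'. extreme_move D i v v' u u' (\<sigma> i - \<sigma> (i - 1))"
  shows "\<sigma> t \<in> backward_levels D t"
proof -
  let ?I = "{t + 1..horizon D}"
  define \<delta> where "\<delta> = (\<lambda>i. if i \<le> k then \<sigma> i - \<sigma> (i - 1) else 0)"
  have "\<forall>i\<in>?I. \<exists>v v' u u'. extreme_move D i v v' u u' (\<delta> i)"
    using move extreme_move_0 by (fastforce simp: \<delta>_def)
  then obtain v v' u u' where m: "\<forall>i\<in>?I. extreme_move D i (v i) (v' i) (u i) (u' i) (\<delta> i)"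
    by metis
  have "\<sigma> k - \<sigma> t = (\<Sum>i\<in>{Suc t..k}. \<sigma> i - \<sigma> (i - 1))"
    using sum_telescope''[of t k \<sigma>] k by simp
  also have "\<dots> = (\<Sum>i\<in>?I. \<delta> i)"
    using k by (intro sum.mono_neutral_cong_left) (auto simp: \<delta>_def)
  also have "\<dots> = (\<Sum>i\<in>?I. (u i * Lx D i + u' i * Ux D i) - (v i * Ly D i + v' i * Uy D i))"
    using m by (intro sum.cong) (auto simp: extreme_move_def)
  finally have "\<sigma> t = \<sigma> k + (\<Sum>i\<in>?I. v i * Ly D i + v' i * Uy D i)
      - (\<Sum>i\<in>?I. u i * Lx D i + u' i * Ux D i)"
    by (simp add: sum_subtractf)
  then show ?thesis
    unfolding backward_levels_def mem_Collect_eq using K m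
    by (intro exI[of _ "\<sigma> k"] exI[of _ v] exI[of _ v'] exI[of _ u] exI[of _ u'])
      (simp add: extreme_move_def Pi_iff)
qed

text \<open>With period 0 as a layer of its own, balance and telescoping need no exception for
  period 1. The raw coordinate \<open>s_val p 0\<close> is 0 on the point space.\<close>

definition stock :: "stock_data \<Rightarrow> point \<Rightarrow> nat \<Rightarrow> real" where
  "stock D p t = (if t = 0 then init_stock D else s_val p t)"

lemma Q1_iff:
  "p \<in> Q1 D \<longleftrightarrow> p \<in> point_space (horizon D) \<and> (\<forall>t\<in>{1..horizon D}.
     w_val p t \<in> {0, 1} \<and> z_val p t \<in> {0, 1} \<and>
     s_val p t = stock D p (t - 1) - y_val p t + x_val p t \<and> x_val p t * y_val p t = 0 \<and>
     Ls D t \<le> s_val p t \<and> s_val p t \<le> Us D t \<and>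
     Ly D t * z_val p t \<le> y_val p t \<and> y_val p t \<le> Uy D t * z_val p t \<and>
     Lx D t * w_val p t \<le> x_val p t \<and> x_val p t \<le> Ux D t * w_val p t)"
proof -
  have "prev_stock D (fst (snd (snd p))) t = stock D p (t - 1)" if "t \<in> {1..horizon D}" for t
    using that by (auto simp: prev_stock_def stock_def val_defs)
  then show ?thesis
    by (cases p) (simp add: Q1_def val_defs)
qed

section \<open>Stocks of vertices\<close>

text \<open>Each \<open>p\<^sub>0\<close> gets its own polytope: freezing its binaries and the zeros
  of \<open>x\<close> and \<open>y\<close> makes complementarity linear, so the vertices lie in
  \<open>Q1 D\<close> again and only their stocks remain to be located.\<close>

lemma Q1_subset_hull_stock_levels:
  assumes valid: "valid_data D"
  shows "Q1 D \<subseteq> convex hull {p \<in> Q1 D. \<forall>t\<in>{1..horizon D}. s_val p t \<in> stock_levels D t}"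
proof
  fix p\<^sub>0 assume p0: "p\<^sub>0 \<in> Q1 D"
  let ?T = "horizon D"
  let ?C = "{p \<in> Q1 D. \<forall>t\<in>{1..?T}. s_val p t \<in> stock_levels D t}"
  \<comment> \<open>Every bound is written as \<open>c \<le> g p\<close>, upper bounds by negation,
    with the binaries of \<open>p\<^sub>0\<close> as constants.\<close>
  define J where "J = (\<Union>t\<in>{1..?T}.
    {(\<lambda>p. x_val p t, Lx D t * w_val p\<^sub>0 t), (\<lambda>p. - x_val p t, - (Ux D t * w_val p\<^sub>0 t)),
     (\<lambda>p. y_val p t, Ly D t * z_val p\<^sub>0 t), (\<lambda>p. - y_val p t, - (Uy D t * z_val p\<^sub>0 t)),
     (\<lambda>p. s_val p t, Ls D t), (\<lambda>p. - s_val p t, - Us D t)})"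
  \<comment> \<open>For \<open>t = 1\<close> the term \<open>s_val d 0\<close> vanishes on the point
    space, which keeps the initial stock fixed.\<close>
  define W where "W = {d \<in> point_space ?T. \<forall>t\<in>{1..?T}. w_val d t = 0 \<and> z_val d t = 0 \<and>
    s_val d t = s_val d (t - 1) - y_val d t + x_val d t \<and>
    (x_val p\<^sub>0 t = 0 \<longrightarrow> x_val d t = 0) \<and> (y_val p\<^sub>0 t = 0 \<longrightarrow> y_val d t = 0)}"
  show "p\<^sub>0 \<in> convex hull ?C"
  proof (rule polyhedron_vertex_induct[where J = J and W = W])
    show "finite J" by (simp add: J_def)
    show "linear g" if "(g, c) \<in> J" for g c
      using that by (auto simp: J_def intro!: linear_val linear_compose_neg)
    show "subspace W"
    proof (rule subspaceI)
      show "0 \<in> W" by (simp add: W_def subspace_0[OF subspace_point_space])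
      show "d + e \<in> W" if "d \<in> W" "e \<in> W" for d e
        using that by (simp add: W_def subspace_add[OF subspace_point_space])
      show "r *\<^sub>R d \<in> W" if "d \<in> W" for r d
        using that by (simp add: W_def subspace_scale[OF subspace_point_space]
            right_diff_distrib distrib_left)
    qed
    show "convex (convex hull ?C)" by (rule convex_convex_hull)
    show "c \<le> g p\<^sub>0" if "(g, c) \<in> J" for g c
      using that p0 by (auto simp: J_def Q1_iff)
  next
    fix d assume d: "d \<in> W" "d \<noteq> 0"
    show "\<exists>(g, c)\<in>J. g d < 0"
    \<comment> \<open>Each of \<open>x\<close>, \<open>y\<close>, \<open>s\<close> is bounded on
      both sides, so a direction that decreases no constraint vanishes there; \<open>w\<close> and
      \<open>z\<close> are constant along \<open>W\<close>.\<close>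
    proof (rule ccontr)
      assume "\<not> (\<exists>(g, c)\<in>J. g d < 0)"
      then have nonneg: "\<forall>(g, c)\<in>J. 0 \<le> g d" by force
      have "d = 0"
      proof (rule point_eqI)
        show "d \<in> point_space ?T" "0 \<in> point_space ?T"
          using d(1) by (auto simp: W_def subspace_0 subspace_point_space)
        fix t assume t: "t \<in> {1..?T}"
        have "0 \<le> x_val d t" "0 \<le> - x_val d t" "0 \<le> y_val d t" "0 \<le> - y_val d t"
          "0 \<le> s_val d t" "0 \<le> - s_val d t"
          using nonneg t by (auto simp: J_def)
        then show "x_val d t = x_val 0 t" "y_val d t = y_val 0 t" "s_val d t = s_val 0 t"
          "w_val d t = w_val 0 t" "z_val d t = z_val 0 t"
          using d(1) t by (simp_all add: W_def)
      qed
      with d(2) show False ..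
    qed
  next
    fix v assume vW: "v - p\<^sub>0 \<in> W" and feas: "\<And>g c. (g, c) \<in> J \<Longrightarrow> c \<le> g v"
      and ext: "\<And>d. d \<in> W \<Longrightarrow> (\<And>g c. (g, c) \<in> J \<Longrightarrow> g v = c \<Longrightarrow> g d = 0) \<Longrightarrow> d = 0"
    have bounds: "Lx D t * w_val p\<^sub>0 t \<le> x_val v t" "x_val v t \<le> Ux D t * w_val p\<^sub>0 t"
      "Ly D t * z_val p\<^sub>0 t \<le> y_val v t" "y_val v t \<le> Uy D t * z_val p\<^sub>0 t"
      "Ls D t \<le> s_val v t" "s_val v t \<le> Us D t" if "t \<in> {1..?T}" for t
    proof -
      have "\<forall>(g, c)\<in>J. c \<le> g v" using feas by blast
      then show "Lx D t * w_val p\<^sub>0 t \<le> x_val v t" "x_val v t \<le> Ux D t * w_val p\<^sub>0 t"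
        "Ly D t * z_val p\<^sub>0 t \<le> y_val v t" "y_val v t \<le> Uy D t * z_val p\<^sub>0 t"
        "Ls D t \<le> s_val v t" "s_val v t \<le> Us D t"
        using that by (auto simp: J_def)
    qed
    have v_space: "v \<in> point_space ?T"
      using subspace_add[OF subspace_point_space, of "v - p\<^sub>0" ?T p\<^sub>0] vW p0
      by (simp add: W_def Q1_iff)
    have p0_t: "w_val p\<^sub>0 t \<in> {0, 1}" "z_val p\<^sub>0 t \<in> {0, 1}" "x_val p\<^sub>0 t = 0 \<or> y_val p\<^sub>0 t = 0"
      "s_val p\<^sub>0 t = stock D p\<^sub>0 (t - 1) - y_val p\<^sub>0 t + x_val p\<^sub>0 t" if "t \<in> {1..?T}" for t
      using p0 that by (auto simp: Q1_iff)
    have vW_t: "w_val v t = w_val p\<^sub>0 t" "z_val v t = z_val p\<^sub>0 t"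
      "s_val v t - s_val p\<^sub>0 t = (s_val v (t - 1) - s_val p\<^sub>0 (t - 1))
          - (y_val v t - y_val p\<^sub>0 t) + (x_val v t - x_val p\<^sub>0 t)"
      "x_val p\<^sub>0 t = 0 \<longrightarrow> x_val v t = 0" "y_val p\<^sub>0 t = 0 \<longrightarrow> y_val v t = 0"
      if "t \<in> {1..?T}" for t
      using vW that by (auto simp: W_def)
    have zero: "s_val v 0 = 0" "s_val p\<^sub>0 0 = 0"
      using v_space p0 by (auto simp: point_space_iff Q1_iff)
    have v_xy: "x_val v t = 0 \<or> y_val v t = 0" if "t \<in> {1..?T}" for t
      using p0_t[OF that] vW_t[OF that] by blast
    have v_step: "stock D v t = stock D v (t - 1) - y_val v t + x_val v t" if "t \<in> {1..?T}" for t
      using p0_t(4)[OF that] vW_t(3)[OF that] zero that by (auto simp: stock_def split: if_splits)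
    have v_Q1: "v \<in> Q1 D"
      unfolding Q1_iff
    proof (intro conjI ballI v_space)
      fix t assume t: "t \<in> {1..?T}"
      show "s_val v t = stock D v (t - 1) - y_val v t + x_val v t"
        using v_step[OF t] t by (auto simp: stock_def)
      show "x_val v t * y_val v t = 0" using v_xy[OF t] by auto
    qed (use bounds p0_t vW_t in auto)
    define tight where "tight = (\<lambda>i. x_val v i \<in> {Lx D i * w_val p\<^sub>0 i, Ux D i * w_val p\<^sub>0 i} \<and>
      y_val v i \<in> {Ly D i * z_val p\<^sub>0 i, Uy D i * z_val p\<^sub>0 i})"
    \<comment> \<open>With binary \<open>w\<close> and \<open>z\<close> every bound is 0 or one of
      the data, and at most one of \<open>x\<close>, \<open>y\<close> is nonzero; this leaves five
      possible stock changes.\<close>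
    have tight_move: "\<exists>a a' b b'. extreme_move D i a a' b b' (stock D v i - stock D v (i - 1))"
      if ti: "tight i" "i \<in> {1..?T}" for i
    proof -
      have \<delta>: "stock D v i - stock D v (i - 1) = x_val v i - y_val v i"
        using v_step[OF ti(2)] by simp
      have "(x_val v i = 0 \<or> x_val v i = Lx D i \<or> x_val v i = Ux D i) \<and>
        (y_val v i = 0 \<or> y_val v i = Ly D i \<or> y_val v i = Uy D i)"
        using ti p0_t(1,2)[OF ti(2)] by (auto simp: tight_def)
      then consider "x_val v i - y_val v i = 0" | "x_val v i - y_val v i = Lx D i"
        | "x_val v i - y_val v i = Ux D i" | "x_val v i - y_val v i = - Ly D i"
        | "x_val v i - y_val v i = - Uy D i"
        using v_xy[OF ti(2)] by fastforce
      then show ?thesis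
      proof cases
        case 1 then show ?thesis unfolding \<delta> using extreme_move_0 by metis
      next
        case 2
        then have "extreme_move D i 0 0 1 0 (x_val v i - y_val v i)" by (simp add: extreme_move_def)
        then show ?thesis unfolding \<delta> by blast
      next
        case 3
        then have "extreme_move D i 0 0 0 1 (x_val v i - y_val v i)" by (simp add: extreme_move_def)
        then show ?thesis unfolding \<delta> by blast
      next
        case 4
        then have "extreme_move D i 1 0 0 0 (x_val v i - y_val v i)" by (simp add: extreme_move_def)
        then show ?thesis unfolding \<delta> by blast
      next
        case 5
        then have "extreme_move D i 0 1 0 0 (x_val v i - y_val v i)" by (simp add: extreme_move_def)
        then show ?thesis unfolding \<delta> by blast
      qed
    qed
    \<comment> \<open>The data are nonnegative, so a variable with value 0 sits at its lower
      bound.\<close>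
    have zero_tight: "tight i" if "x_val v i = 0" "y_val v i = 0" "i \<in> {1..?T}" for i
    proof -
      have "0 \<le> Lx D i * w_val p\<^sub>0 i" "0 \<le> Ly D i * z_val p\<^sub>0 i"
        using valid p0_t(1,2)[OF that(3)] that(3) by (auto simp: valid_data_def)
      then show ?thesis using bounds[OF that(3)] that(1,2) by (auto simp: tight_def)
    qed
    have zero_tight_x: "x_val v i \<in> {Lx D i * w_val p\<^sub>0 i, Ux D i * w_val p\<^sub>0 i}"
      if "x_val v i = 0" "i \<in> {1..?T}" for i
    proof -
      have "0 \<le> Lx D i * w_val p\<^sub>0 i"
        using valid p0_t(1)[OF that(2)] that(2) by (auto simp: valid_data_def)
      then show ?thesis using bounds[OF that(2)] that(1) by auto
    qed
    have zero_tight_y: "y_val v i \<in> {Ly D i * z_val p\<^sub>0 i, Uy D i * z_val p\<^sub>0 i}"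
      if "y_val v i = 0" "i \<in> {1..?T}" for i
    proof -
      have "0 \<le> Ly D i * z_val p\<^sub>0 i"
        using valid p0_t(2)[OF that(2)] that(2) by (auto simp: valid_data_def)
      then show ?thesis using bounds[OF that(2)] that(1) by auto
    qed
    have "s_val v t \<in> stock_levels D t" if t: "t \<in> {1..?T}" for t
    proof (rule ccontr)
      assume notin: "s_val v t \<notin> stock_levels D t"
      \<comment> \<open>All moves between \<open>i\<close> and \<open>t\<close> are tight. Move
        \<open>j\<close> leads from period \<open>j - 1\<close> to \<open>j\<close>, hence the
        half-open range; it is empty for \<open>i = t\<close>, so \<open>t\<close> is
        linked.\<close>
      define linked where "linked = (\<lambda>i. i \<in> {1..?T} \<and> (\<forall>j. min i t < j \<and> j \<le> max i t \<longrightarrow> tight j))"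
      have not_levels: "stock D v t \<notin> forward_levels D t" "stock D v t \<notin> backward_levels D t"
        using notin t bounds[OF t] by (auto simp: stock_levels_def stock_def)
      \<comment> \<open>Otherwise extreme moves would connect the stock of \<open>t\<close> with the
        initial stock.\<close>
      have no_init: "\<exists>j\<in>{1..t}. \<not> tight j"
      proof (rule ccontr)
        assume "\<not> (\<exists>j\<in>{1..t}. \<not> tight j)"
        then have "stock D v t \<in> forward_levels D t"
          using t tight_move by (intro forward_levelsI[of 0]) (auto simp: stock_def)
        with not_levels show False by blast
      qed
      \<comment> \<open>A linked period at a stock bound would put the stock of \<open>t\<close>
        into the forward or the backward levels, depending on its side of \<open>t\<close>.\<close>
      have linked_free: "s_val v i \<noteq> Ls D i \<and> s_val v i \<noteq> Us D i" if i: "linked i" for i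
      proof (rule ccontr)
        assume "\<not> (s_val v i \<noteq> Ls D i \<and> s_val v i \<noteq> Us D i)"
        then have s: "s_val v i = Ls D i \<or> s_val v i = Us D i" by blast
        have iT: "i \<in> {1..?T}" using i by (simp add: linked_def)
        show False
        proof (cases "i \<le> t")
          case True
          have "stock D v t \<in> forward_levels D t"
          proof (rule forward_levelsI[OF True])
            show "stock D v i \<in> {init_stock D} \<union> Us D ` {1..t} \<union> Ls D ` {1..t}"
              using s iT True by (auto simp: stock_def)
            show "\<exists>a a' b b'. extreme_move D j a a' b b' (stock D v j - stock D v (j - 1))"
              if "i < j" "j \<le> t" for j
              using that i t True by (intro tight_move) (auto simp: linked_def)
          qed
          with not_levels show False by blast
        next
          case False
          have "stock D v t \<in> backward_levels D t"
          proof (rule backward_levelsI[of t i])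
            show "stock D v i \<in> Us D ` {t + 1..?T} \<union> Ls D ` {t + 1..?T}"
              using s iT False by (auto simp: stock_def)
            show "\<exists>a a' b b'. extreme_move D j a a' b b' (stock D v j - stock D v (j - 1))"
              if "t < j" "j \<le> i" for j
              using that i t iT by (intro tight_move) (auto simp: linked_def)
          qed (use False iT in auto)
          with not_levels show False by blast
        qed
      qed
      \<comment> \<open>Shifting the stock on the linked block changes no tight constraint, so \<open>v\<close> is not a vertex.\<close>
      define \<sigma> :: "nat \<Rightarrow> real" where "\<sigma> = (\<lambda>i. if linked i then 1 else 0)"
      \<comment> \<open>A tight move has both ends in the block or both outside. Period 0 is never
        linked, so at \<open>i = 1\<close> it takes \<open>no_init\<close> to exclude that period 1
        is.\<close>
      have \<sigma>_tight: "\<sigma> i = \<sigma> (i - 1)" if i: "tight i" "i \<in> {1..?T}" for i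
      proof (cases "i = 1")
        case True
        have "\<not> linked 1"
        proof
          assume l: "linked 1"
          have "tight j" if "j \<in> {1..t}" for j
            using that l i True by (cases "j = 1") (auto simp: linked_def)
          with no_init show False by blast
        qed
        then show ?thesis using True by (simp add: \<sigma>_def linked_def)
      next
        case False
        have "linked i \<longleftrightarrow> linked (i - 1)"
        proof (cases "i \<le> t")
          case True
          have "min (i - 1) t < j \<and> j \<le> max (i - 1) t \<longleftrightarrow> j = i \<or> min i t < j \<and> j \<le> max i t" for j
            using True i by auto
          then show ?thesis using False i by (auto simp: linked_def)
        next
          case F: False
          have "min i t < j \<and> j \<le> max i t \<longleftrightarrow> j = i \<or> min (i - 1) t < j \<and> j \<le> max (i - 1) t" for j
            using F i by auto
          then show ?thesis using False i by (auto simp: linked_def)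
        qed
        then show ?thesis by (simp add: \<sigma>_def)
      qed
      \<comment> \<open>The change of \<open>\<sigma>\<close> is carried by whichever of
        \<open>x\<close>, \<open>y\<close> is nonzero. If both vanish, the move is tight by
        \<open>zero_tight\<close> and \<open>\<sigma>\<close> does not change, so balance
        holds.\<close>
      define d where "d = (\<Sum>i\<in>{1..?T}. unit_point i
        (if x_val v i \<noteq> 0 then \<sigma> i - \<sigma> (i - 1) else 0)
        (if y_val v i \<noteq> 0 then \<sigma> (i - 1) - \<sigma> i else 0) (\<sigma> i) 0 0)"
      have d_val: "x_val d i = (if x_val v i \<noteq> 0 then \<sigma> i - \<sigma> (i - 1) else 0)"
        "y_val d i = (if y_val v i \<noteq> 0 then \<sigma> (i - 1) - \<sigma> i else 0)"
        "w_val d i = 0" "z_val d i = 0" if "i \<in> {1..?T}" for i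
        using that by (simp_all add: d_def)
      have d_s: "s_val d i = \<sigma> i" for i
        by (simp add: d_def \<sigma>_def linked_def)
      have d_space: "d \<in> point_space ?T"
        unfolding d_def by (intro subspace_sum[OF subspace_point_space] unit_point_in_point_space)
      have "d \<in> W"
        unfolding W_def
      proof (intro CollectI conjI ballI d_space)
        fix i assume i: "i \<in> {1..?T}"
        show "s_val d i = s_val d (i - 1) - y_val d i + x_val d i"
          using v_xy[OF i] zero_tight[of i] \<sigma>_tight[of i] i by (auto simp: d_val[OF i] d_s)
      qed (use d_val vW_t in auto)
      moreover have "g d = 0" if gc: "(g, c) \<in> J" "g v = c" for g c
      proof -
        obtain i where i: "i \<in> {1..?T}" and
          g: "(g, c) \<in> {(\<lambda>p. x_val p i, Lx D i * w_val p\<^sub>0 i), (\<lambda>p. - x_val p i, - (Ux D i * w_val p\<^sub>0 i)),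
           (\<lambda>p. y_val p i, Ly D i * z_val p\<^sub>0 i), (\<lambda>p. - y_val p i, - (Uy D i * z_val p\<^sub>0 i)),
           (\<lambda>p. s_val p i, Ls D i), (\<lambda>p. - s_val p i, - Us D i)}"
          using gc(1) unfolding J_def by blast
        \<comment> \<open>A nonzero \<open>x\<close> at a bound forces \<open>y = 0\<close>, which
          is also at a bound; so the move is tight and \<open>\<sigma>\<close> is constant across
          it.\<close>
        have x: "x_val d i = 0" if "x_val v i \<in> {Lx D i * w_val p\<^sub>0 i, Ux D i * w_val p\<^sub>0 i}"
          using that zero_tight_y[of i] v_xy[OF i] \<sigma>_tight[of i] i by (auto simp: d_val tight_def)
        have y: "y_val d i = 0" if "y_val v i \<in> {Ly D i * z_val p\<^sub>0 i, Uy D i * z_val p\<^sub>0 i}"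
          using that zero_tight_x[of i] v_xy[OF i] \<sigma>_tight[of i] i by (auto simp: d_val tight_def)
        have s: "s_val d i = 0" if "s_val v i \<in> {Ls D i, Us D i}"
          using that linked_free[of i] by (auto simp: d_s \<sigma>_def)
        show ?thesis using g gc(2) x y s by auto
      qed
      ultimately have "d = 0" by (rule ext)
      moreover have "s_val d t = 1"
        using t by (simp add: d_s \<sigma>_def linked_def)
      ultimately show False by simp
    qed
    then show "v \<in> convex hull ?C" using v_Q1 by (intro hull_inc) auto
  qed
qed

section \<open>The stock level network\<close>

definition levels :: "stock_data \<Rightarrow> nat \<Rightarrow> real set" where
  "levels D t = (if t = 0 then {init_stock D} else stock_levels D t)"

text \<open>On \<open>Q1 D\<close> complementarity makes \<open>x\<close> and \<open>y\<close> the
  positive parts of the stock change and of its negative, so the two end levels determine them; only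
  the binaries distinguish parallel arcs.\<close>

definition arcs :: "stock_data \<Rightarrow> nat \<Rightarrow> (real \<times> real \<times> real \<times> real) set" where
  "arcs D t = {(a, b, w, z). a \<in> levels D (t - 1) \<and> b \<in> levels D t \<and> w \<in> {0, 1} \<and> z \<in> {0, 1} \<and>
     Ly D t * z \<le> max (a - b) 0 \<and> max (a - b) 0 \<le> Uy D t * z \<and>
     Lx D t * w \<le> max (b - a) 0 \<and> max (b - a) 0 \<le> Ux D t * w}"

definition arc_tail :: "real \<times> real \<times> real \<times> real \<Rightarrow> real" where "arc_tail e = fst e"
definition arc_head :: "real \<times> real \<times> real \<times> real \<Rightarrow> real" where "arc_head e = fst (snd e)"

text \<open>The stock is taken from the head only, so the layers of a path contribute to disjoint
  coordinates.\<close>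

definition arc_point :: "nat \<Rightarrow> real \<times> real \<times> real \<times> real \<Rightarrow> point" where
  "arc_point t = (\<lambda>(a, b, w, z). unit_point t (max (b - a) 0) (max (a - b) 0) b w z)"

definition layered_arcs :: "stock_data \<Rightarrow> (nat \<times> real \<times> real \<times> real \<times> real) set" where
  "layered_arcs D = Sigma {1..horizon D} (arcs D)"

text \<open>
  The pair \<open>(0, 0)\<close> stands for the source; its balance equation, imposed on layer 1, says that one
  unit of flow is sent. No equation is needed in the last layer.
\<close>

definition nodes :: "stock_data \<Rightarrow> (nat \<times> real) set" where
  "nodes D = insert (0, 0) (Sigma {1..<horizon D} (levels D))"

text \<open>Inflow minus outflow at an inner node. For the source, the total flow on layer 1
  suffices, as all its arcs leave the single node of layer 0.\<close>

definition incidence :: "nat \<times> real \<Rightarrow> nat \<times> real \<times> real \<times> real \<times> real \<Rightarrow> real" where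
  "incidence = (\<lambda>(t, n) (i, e). if t = 0 then of_bool (i = 1)
     else of_bool (i = t \<and> arc_head e = n) - of_bool (i = Suc t \<and> arc_tail e = n))"

definition unit_supply :: "nat \<times> real \<Rightarrow> real" where "unit_supply = (\<lambda>(t, n). of_bool (t = 0))"

text \<open>The projection of the flow polytope, in the shape that
  \<open>extended_formulation_of_weights\<close> expects.\<close>

definition flow_points :: "stock_data \<Rightarrow> point set" where
  "flow_points D = {\<Sum>e\<in>layered_arcs D. f e *\<^sub>R case_prod arc_point e | f.
     (\<forall>e\<in>layered_arcs D. 0 \<le> f e) \<and>
     (\<forall>k\<in>nodes D. (\<Sum>e\<in>layered_arcs D. incidence k e * f e) = unit_supply k)}"

lemma finite_levels: "finite (levels D t)"
  by (simp add: levels_def finite_stock_levels)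

lemma arcs_subset: "arcs D t \<subseteq> levels D (t - 1) \<times> levels D t \<times> {0, 1} \<times> {0, 1}"
  by (auto simp: arcs_def)

lemma finite_arcs: "finite (arcs D t)"
  by (rule finite_subset[OF arcs_subset]) (simp add: finite_levels)

lemma finite_layered_arcs: "finite (layered_arcs D)"
  by (simp add: layered_arcs_def finite_arcs)

lemma finite_nodes: "finite (nodes D)"
  by (simp add: nodes_def finite_levels)

lemma sum_layered_arcs:
  "(\<Sum>e\<in>layered_arcs D. g e) = (\<Sum>t=1..horizon D. \<Sum>e\<in>arcs D t. g (t, e))"
  unfolding layered_arcs_def by (subst sum.Sigma) (auto simp: finite_arcs case_prod_unfold)

lemma sum_layer:
  fixes f :: "nat \<times> real \<times> real \<times> real \<times> real \<Rightarrow> real"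
  assumes "t \<in> {1..horizon D}"
  shows "(\<Sum>e\<in>layered_arcs D. of_bool (fst e = t \<and> P (snd e)) * f e)
    = (\<Sum>e\<in>{e \<in> arcs D t. P e}. f (t, e))"
proof -
  have "(\<Sum>e\<in>layered_arcs D. of_bool (fst e = t \<and> P (snd e)) * f e)
      = (\<Sum>i=1..horizon D. if i = t then (\<Sum>e\<in>arcs D t. of_bool (P e) * f (t, e)) else 0)"
    unfolding sum_layered_arcs by (intro sum.cong) auto
  also have "\<dots> = (\<Sum>e\<in>arcs D t. of_bool (P e) * f (t, e))"
    using assms by (subst sum.delta) auto
  also have "\<dots> = (\<Sum>e\<in>{e \<in> arcs D t. P e}. f (t, e))"
    using finite_arcs[of D t] by (intro sum.mono_neutral_cong_right) auto
  finally show ?thesis .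
qed

section \<open>Flows project onto P_1\<close>

text \<open>Arcs respect the bounds of their own period, and linking makes each tail the previous
  stock. Complementarity holds because the positive parts of a number and of its negative are never
  both nonzero.\<close>

lemma path_in_Q1:
  assumes arc: "\<And>t. t \<in> {1..horizon D} \<Longrightarrow> \<pi> t \<in> arcs D t"
    and link: "\<And>t. t \<in> {1..<horizon D} \<Longrightarrow> arc_head (\<pi> t) = arc_tail (\<pi> (Suc t))"
  shows "(\<Sum>t=1..horizon D. arc_point t (\<pi> t)) \<in> Q1 D"
proof -
  let ?T = "horizon D" and ?p = "\<Sum>t=1..horizon D. arc_point t (\<pi> t)"
  have val: "x_val ?p t = max (b - a) 0 \<and> y_val ?p t = max (a - b) 0 \<and> s_val ?p t = b \<and>
      w_val ?p t = w \<and> z_val ?p t = z"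
    if "t \<in> {1..?T}" "\<pi> t = (a, b, w, z)" for t a b w z
  proof -
    have "(\<Sum>i=1..?T. g (arc_point i (\<pi> i)) t) = g (arc_point t (\<pi> t)) t"
      if "\<And>i e. i \<noteq> t \<Longrightarrow> g (arc_point i e) t = 0" for g :: "point \<Rightarrow> nat \<Rightarrow> real"
    proof -
      have "(\<Sum>i=1..?T. g (arc_point i (\<pi> i)) t)
          = (\<Sum>i=1..?T. if i = t then g (arc_point t (\<pi> t)) t else 0)"
        using that by (intro sum.cong) auto
      also have "\<dots> = g (arc_point t (\<pi> t)) t"
        using \<open>t \<in> {1..?T}\<close> by (subst sum.delta) auto
      finally show ?thesis .
    qed
    note pick = this
    have off: "x_val (arc_point i e) t = 0" "y_val (arc_point i e) t = 0"
      "s_val (arc_point i e) t = 0" "w_val (arc_point i e) t = 0" "z_val (arc_point i e) t = 0"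
      if "i \<noteq> t" for i e
      using that by (simp_all add: arc_point_def split: prod.split)
    have "x_val ?p t = x_val (arc_point t (\<pi> t)) t"
      unfolding val_sum by (rule pick) (rule off)
    moreover have "y_val ?p t = y_val (arc_point t (\<pi> t)) t"
      unfolding val_sum by (rule pick) (rule off)
    moreover have "s_val ?p t = s_val (arc_point t (\<pi> t)) t"
      unfolding val_sum by (rule pick) (rule off)
    moreover have "w_val ?p t = w_val (arc_point t (\<pi> t)) t"
      unfolding val_sum by (rule pick) (rule off)
    moreover have "z_val ?p t = z_val (arc_point t (\<pi> t)) t"
      unfolding val_sum by (rule pick) (rule off)
    ultimately show ?thesis by (simp add: arc_point_def that(2))
  qed
  \<comment> \<open>Linking says nothing about the first tail, but layer 0 contains only the initial
    stock.\<close>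
  have stock: "stock D ?p (t - 1) = arc_tail (\<pi> t)" if t: "t \<in> {1..?T}" for t
  proof (cases "t = 1")
    case True
    then have "arc_tail (\<pi> 1) = init_stock D"
      using arc[of 1] t by (auto simp: arcs_def arc_tail_def levels_def)
    then show ?thesis using True by (simp add: stock_def)
  next
    case False
    then have t': "t - 1 \<in> {1..?T}" "t - 1 \<in> {1..<?T}" "Suc (t - 1) = t" using t by auto
    obtain a b w z where e: "\<pi> (t - 1) = (a, b, w, z)" by (metis prod_cases4)
    have "s_val ?p (t - 1) = arc_head (\<pi> (t - 1))"
      using val[OF t'(1) e] e by (simp add: arc_head_def)
    then show ?thesis using link[OF t'(2)] t' by (auto simp: stock_def)
  qed
  have "arc_point t e \<in> point_space ?T" if "t \<in> {1..?T}" for t e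
    using that by (cases e) (auto simp: arc_point_def intro!: unit_point_in_point_space)
  then have space: "?p \<in> point_space ?T"
    by (intro subspace_sum[OF subspace_point_space]) auto
  show ?thesis
    unfolding Q1_iff
  proof (intro conjI[OF space] ballI)
    fix t assume t: "t \<in> {1..?T}"
    obtain a b w z where e: "\<pi> t = (a, b, w, z)" by (metis prod_cases4)
    have "b \<in> stock_levels D t" using arc[OF t] e t by (auto simp: arcs_def levels_def)
    then have "Ls D t \<le> b" "b \<le> Us D t" by (auto simp: stock_levels_def)
    moreover have "stock D ?p (t - 1) = a" using stock[OF t] e by (simp add: arc_tail_def)
    moreover have "w \<in> {0, 1} \<and> z \<in> {0, 1} \<and>
     Ly D t * z \<le> max (a - b) 0 \<and> max (a - b) 0 \<le> Uy D t * z \<and>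
     Lx D t * w \<le> max (b - a) 0 \<and> max (b - a) 0 \<le> Ux D t * w"
      using arc[OF t] e by (simp add: arcs_def)
    moreover have "b = a - max (a - b) 0 + max (b - a) 0" "max (b - a) 0 * max (a - b) 0 = 0"
      by (auto simp: max_def)
    moreover note val[OF t e]
    ultimately show "w_val ?p t \<in> {0, 1} \<and> z_val ?p t \<in> {0, 1} \<and>
       s_val ?p t = stock D ?p (t - 1) - y_val ?p t + x_val ?p t \<and> x_val ?p t * y_val ?p t = 0 \<and>
       Ls D t \<le> s_val ?p t \<and> s_val ?p t \<le> Us D t \<and>
       Ly D t * z_val ?p t \<le> y_val ?p t \<and> y_val ?p t \<le> Uy D t * z_val ?p t \<and>
       Lx D t * w_val ?p t \<le> x_val ?p t \<and> x_val ?p t \<le> Ux D t * w_val ?p t"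
      by presburger
  qed
qed

lemma flow_points_subset_P1:
  assumes "valid_data D"
  shows "flow_points D \<subseteq> P1 D"
proof
  let ?T = "horizon D"
  have T: "1 \<le> ?T" using assms by (simp add: valid_data_def)
  fix p assume "p \<in> flow_points D"
  then obtain f where p: "p = (\<Sum>e\<in>layered_arcs D. f e *\<^sub>R case_prod arc_point e)"
    and nonneg: "\<And>e. e \<in> layered_arcs D \<Longrightarrow> 0 \<le> f e"
    and bal: "\<And>k. k \<in> nodes D \<Longrightarrow> (\<Sum>e\<in>layered_arcs D. incidence k e * f e) = unit_supply k"
    unfolding flow_points_def by blast
  \<comment> \<open>The path decomposition asks for strictly positive flows; dropping the arcs
    without flow changes no sum.\<close>
  define A where "A = (\<lambda>t. {e \<in> arcs D t. 0 < f (t, e)})"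
  have zero: "f (t, e) = 0" if "t \<in> {1..?T}" "e \<in> arcs D t" "e \<notin> A t" for t e
    using nonneg[of "(t, e)"] that by (force simp: A_def layered_arcs_def)
  have sum_A: "(\<Sum>e\<in>{e \<in> A t. P e}. f (t, e)) = (\<Sum>e\<in>{e \<in> arcs D t. P e}. f (t, e))"
    if "t \<in> {1..?T}" for t P
    using that finite_arcs[of D t] zero[OF that] by (intro sum.mono_neutral_left) (auto simp: A_def)
  let ?paths = "{\<Sum>t=1..?T. arc_point t (\<pi> t) | \<pi>. (\<forall>t\<in>{1..?T}. \<pi> t \<in> A t) \<and>
       (\<forall>t\<in>{1..<?T}. arc_head (\<pi> t) = arc_tail (\<pi> (Suc t)))}"
  have "(\<Sum>t=1..?T. \<Sum>e\<in>A t. f (t, e) *\<^sub>R arc_point t e) \<in> convex hull ?paths"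
  proof (rule flow_in_path_hull)
    show "finite (A t)" for t using finite_arcs by (simp add: A_def)
    show "0 < f (t, e)" if "e \<in> A t" for t e using that by (simp add: A_def)
    show "(\<Sum>e\<in>{e \<in> A t. arc_head e = n}. f (t, e))
        = (\<Sum>e\<in>{e \<in> A (Suc t). arc_tail e = n}. f (Suc t, e))" if t: "1 \<le> t" "t < ?T" for t n
    proof (cases "n \<in> levels D t")
      case True
      then have "(t, n) \<in> nodes D" using t by (simp add: nodes_def)
      then have "0 = (\<Sum>e\<in>layered_arcs D. incidence (t, n) e * f e)"
        using t by (simp add: bal unit_supply_def)
      also have "\<dots> = (\<Sum>e\<in>layered_arcs D. of_bool (fst e = t \<and> arc_head (snd e) = n) * f e)
          - (\<Sum>e\<in>layered_arcs D. of_bool (fst e = Suc t \<and> arc_tail (snd e) = n) * f e)"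
        using t by (simp add: incidence_def case_prod_unfold left_diff_distrib sum_subtractf)
      also have "\<dots> = (\<Sum>e\<in>{e \<in> arcs D t. arc_head e = n}. f (t, e))
          - (\<Sum>e\<in>{e \<in> arcs D (Suc t). arc_tail e = n}. f (Suc t, e))"
        using t by (subst (1 2) sum_layer) auto
      finally show ?thesis using t by (simp add: sum_A)
    next
      case False
      \<comment> \<open>A value that is no level has no balance equation, but no arc touches it
        either.\<close>
      then have empty: "{e \<in> A t. arc_head e = n} = {}" "{e \<in> A (Suc t). arc_tail e = n} = {}"
        using arcs_subset[of D t] arcs_subset[of D "Suc t"]
        by (auto simp: A_def arc_head_def arc_tail_def)
      show ?thesis unfolding empty by simp
    qed
    have "1 = (\<Sum>e\<in>layered_arcs D. incidence (0, 0) e * f e)"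
      by (simp add: bal unit_supply_def nodes_def)
    also have "\<dots> = (\<Sum>e\<in>layered_arcs D. of_bool (fst e = 1 \<and> True) * f e)"
      by (simp add: incidence_def case_prod_unfold)
    also have "\<dots> = (\<Sum>e\<in>{e \<in> arcs D 1. True}. f (1, e))"
      using T by (intro sum_layer) auto
    finally show "(\<Sum>e\<in>A 1. f (1, e)) = 1"
      using sum_A[of 1 "\<lambda>_. True"] T by simp
    show "1 \<le> ?T" by (rule T)
  qed
  also have "\<dots> \<subseteq> P1 D"
    unfolding P1_def
  proof (rule hull_mono, rule subsetI)
    fix q assume "q \<in> ?paths"
    then obtain \<pi> where \<pi>: "q = (\<Sum>t=1..?T. arc_point t (\<pi> t))" "\<forall>t\<in>{1..?T}. \<pi> t \<in> A t"
      "\<forall>t\<in>{1..<?T}. arc_head (\<pi> t) = arc_tail (\<pi> (Suc t))"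
      by blast
    show "q \<in> Q1 D"
      unfolding \<pi>(1) using \<pi>(2,3) by (intro path_in_Q1) (auto simp: A_def)
  qed
  also have "(\<Sum>t=1..?T. \<Sum>e\<in>A t. f (t, e) *\<^sub>R arc_point t e) = p"
    unfolding p sum_layered_arcs prod.case
    by (intro sum.cong[OF refl] sum.mono_neutral_left finite_arcs) (auto simp: A_def zero)
  finally show "p \<in> P1 D" .
qed

lemma convex_flow_points: "convex (flow_points D)"
proof (rule convexI)
  fix p q :: point and u v :: real
  assume "p \<in> flow_points D" "q \<in> flow_points D" and uv: "0 \<le> u" "0 \<le> v" "u + v = 1"
  then obtain f g where
    p: "p = (\<Sum>e\<in>layered_arcs D. f e *\<^sub>R case_prod arc_point e)" "\<forall>e\<in>layered_arcs D. 0 \<le> f e"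
      "\<forall>k\<in>nodes D. (\<Sum>e\<in>layered_arcs D. incidence k e * f e) = unit_supply k" and
    q: "q = (\<Sum>e\<in>layered_arcs D. g e *\<^sub>R case_prod arc_point e)" "\<forall>e\<in>layered_arcs D. 0 \<le> g e"
      "\<forall>k\<in>nodes D. (\<Sum>e\<in>layered_arcs D. incidence k e * g e) = unit_supply k"
    unfolding flow_points_def by blast
  let ?h = "\<lambda>e. u * f e + v * g e"
  have "u *\<^sub>R p + v *\<^sub>R q = (\<Sum>e\<in>layered_arcs D. ?h e *\<^sub>R case_prod arc_point e)"
    by (simp only: p(1) q(1) scaleR_sum_right scaleR_add_left sum.distrib scaleR_scaleR)
  moreover have "\<forall>e\<in>layered_arcs D. 0 \<le> ?h e"
    using p(2) q(2) uv by auto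
  moreover have "(\<Sum>e\<in>layered_arcs D. incidence k e * ?h e) = unit_supply k" if "k \<in> nodes D" for k
  proof -
    have "(\<Sum>e\<in>layered_arcs D. incidence k e * ?h e)
        = u * (\<Sum>e\<in>layered_arcs D. incidence k e * f e) + v * (\<Sum>e\<in>layered_arcs D. incidence k e * g e)"
      by (simp add: sum_distrib_left distrib_left sum.distrib mult.left_commute)
    also have "\<dots> = (u + v) * unit_supply k" using p(3) q(3) that by (simp add: distrib_right)
    finally show ?thesis using uv by simp
  qed
  ultimately show "u *\<^sub>R p + v *\<^sub>R q \<in> flow_points D"
    unfolding flow_points_def mem_Collect_eq by (intro exI[of _ ?h]) blast
qed

text \<open>Such a point is itself a path in the network, and the indicator function of the path is
  a unit flow.\<close>

lemma level_point_in_flow_points: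
  assumes valid: "valid_data D" and p: "p \<in> Q1 D"
    and lev: "\<And>t. t \<in> {1..horizon D} \<Longrightarrow> s_val p t \<in> stock_levels D t"
  shows "p \<in> flow_points D"
proof -
  let ?T = "horizon D"
  define \<epsilon> where "\<epsilon> = (\<lambda>t. (stock D p (t - 1), s_val p t, w_val p t, z_val p t))"
  have p_t: "w_val p t \<in> {0, 1}" "z_val p t \<in> {0, 1}" "max (s_val p t - stock D p (t - 1)) 0 = x_val p t"
    "max (stock D p (t - 1) - s_val p t) 0 = y_val p t"
    "Ly D t * z_val p t \<le> y_val p t" "y_val p t \<le> Uy D t * z_val p t"
    "Lx D t * w_val p t \<le> x_val p t" "x_val p t \<le> Ux D t * w_val p t" if t: "t \<in> {1..?T}" for t
  proof -
    show wz: "w_val p t \<in> {0, 1}" "z_val p t \<in> {0, 1}"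
      and b: "Ly D t * z_val p t \<le> y_val p t" "y_val p t \<le> Uy D t * z_val p t"
        "Lx D t * w_val p t \<le> x_val p t" "x_val p t \<le> Ux D t * w_val p t"
      using p t by (simp_all add: Q1_iff)
    \<comment> \<open>Nonnegative data make \<open>x\<close> and \<open>y\<close> nonnegative, so
      with complementarity they are recovered from the stock change.\<close>
    have "0 \<le> Lx D t" "0 \<le> Ly D t" using valid t by (auto simp: valid_data_def)
    then have "0 \<le> Lx D t * w_val p t" "0 \<le> Ly D t * z_val p t" using wz by auto
    then have "0 \<le> x_val p t" "0 \<le> y_val p t" using b by linarith+
    moreover have "x_val p t = 0 \<or> y_val p t = 0"
      "s_val p t = stock D p (t - 1) - y_val p t + x_val p t"
      using p t by (simp_all add: Q1_iff)
    ultimately show "max (s_val p t - stock D p (t - 1)) 0 = x_val p t"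
      "max (stock D p (t - 1) - s_val p t) 0 = y_val p t" by (auto simp: max_def)
  qed
  have stock_level: "stock D p t \<in> levels D t" if "t \<le> ?T" for t
    using lev that by (auto simp: stock_def levels_def)
  have \<epsilon>_arc: "\<epsilon> t \<in> arcs D t" if t: "t \<in> {1..?T}" for t
  proof -
    have "stock D p (t - 1) \<in> levels D (t - 1)" "s_val p t \<in> levels D t"
      using stock_level[of "t - 1"] stock_level[of t] t by (auto simp: stock_def)
    then show ?thesis
      unfolding \<epsilon>_def arcs_def mem_Collect_eq prod.case p_t(3,4)[OF t]
      by (intro conjI p_t[OF t])
  qed
  define f :: "nat \<times> real \<times> real \<times> real \<times> real \<Rightarrow> real" where "f = (\<lambda>(t, e). of_bool (e = \<epsilon> t))"
  have pick: "(\<Sum>e\<in>layered_arcs D. f e *\<^sub>R g e) = (\<Sum>t=1..?T. g (t, \<epsilon> t))"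
    for g :: "nat \<times> real \<times> real \<times> real \<times> real \<Rightarrow> point"
    unfolding sum_layered_arcs
  proof (intro sum.cong[OF refl])
    fix t assume t: "t \<in> {1..?T}"
    have "(\<Sum>e\<in>arcs D t. f (t, e) *\<^sub>R g (t, e)) = (\<Sum>e\<in>arcs D t. if e = \<epsilon> t then g (t, \<epsilon> t) else 0)"
      by (intro sum.cong) (auto simp: f_def)
    then show "(\<Sum>e\<in>arcs D t. f (t, e) *\<^sub>R g (t, e)) = g (t, \<epsilon> t)"
      using \<epsilon>_arc[OF t] finite_arcs by simp
  qed
  have pick': "(\<Sum>e\<in>layered_arcs D. g e * f e) = (\<Sum>t=1..?T. g (t, \<epsilon> t))"
    for g :: "nat \<times> real \<times> real \<times> real \<times> real \<Rightarrow> real"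
    unfolding sum_layered_arcs
  proof (intro sum.cong[OF refl])
    fix t assume t: "t \<in> {1..?T}"
    have "(\<Sum>e\<in>arcs D t. g (t, e) * f (t, e)) = (\<Sum>e\<in>arcs D t. if e = \<epsilon> t then g (t, \<epsilon> t) else 0)"
      by (intro sum.cong) (auto simp: f_def)
    then show "(\<Sum>e\<in>arcs D t. g (t, e) * f (t, e)) = g (t, \<epsilon> t)"
      using \<epsilon>_arc[OF t] finite_arcs by simp
  qed
  have "p = (\<Sum>e\<in>layered_arcs D. f e *\<^sub>R case_prod arc_point e)"
    unfolding pick prod.case
  proof (rule point_eqI)
    show "p \<in> point_space ?T" using p by (simp add: Q1_iff)
    have "arc_point t e \<in> point_space ?T" if "t \<in> {1..?T}" for t e
      using that by (cases e) (auto simp: arc_point_def intro!: unit_point_in_point_space)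
    then show "(\<Sum>t=1..?T. arc_point t (\<epsilon> t)) \<in> point_space ?T"
      by (intro subspace_sum[OF subspace_point_space]) auto
  qed (simp_all add: arc_point_def \<epsilon>_def flip: p_t(3,4))
  moreover have "\<forall>e\<in>layered_arcs D. 0 \<le> f e" by (simp add: f_def case_prod_unfold)
  moreover have "\<forall>k\<in>nodes D. (\<Sum>e\<in>layered_arcs D. incidence k e * f e) = unit_supply k"
  proof
    fix k assume "k \<in> nodes D"
    then consider "k = (0, 0)" | t n where "k = (t, n)" "t \<in> {1..<?T}"
      unfolding nodes_def by blast
    then show "(\<Sum>e\<in>layered_arcs D. incidence k e * f e) = unit_supply k"
    proof cases
      case 1
      have "(\<Sum>t=1..?T. of_bool (t = 1)) = (1::real)"
        using valid by (simp add: of_bool_def valid_data_def)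
      then show ?thesis unfolding pick' using 1 by (simp add: incidence_def unit_supply_def)
    next
      case 2
      \<comment> \<open>One arc of the path enters layer \<open>t\<close> and one leaves it, both at
        \<open>s_val p t\<close>. Layer \<open>Suc t\<close> exists because balance is imposed only
        before the last layer.\<close>
      have "(\<Sum>i=1..?T. of_bool (i = t \<and> arc_head (\<epsilon> i) = n)) = (of_bool (s_val p t = n) :: real)"
      proof -
        have "(\<Sum>i=1..?T. of_bool (i = t \<and> arc_head (\<epsilon> i) = n))
            = (\<Sum>i=1..?T. if i = t then of_bool (s_val p t = n) else 0 :: real)"
          by (intro sum.cong) (auto simp: arc_head_def \<epsilon>_def)
        then show ?thesis using 2 by simp
      qed
      moreover have "(\<Sum>i=1..?T. of_bool (i = Suc t \<and> arc_tail (\<epsilon> i) = n)) = (of_bool (s_val p t = n) :: real)"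
      proof -
        have "(\<Sum>i=1..?T. of_bool (i = Suc t \<and> arc_tail (\<epsilon> i) = n))
            = (\<Sum>i=1..?T. if i = Suc t then of_bool (s_val p t = n) else 0 :: real)"
          using 2 by (intro sum.cong) (auto simp: arc_tail_def \<epsilon>_def stock_def)
        then show ?thesis using 2 by simp
      qed
      ultimately show ?thesis
        unfolding pick' using 2 by (simp add: incidence_def unit_supply_def sum_subtractf)
    qed
  qed
  ultimately show ?thesis unfolding flow_points_def by blast
qed

text \<open>As flow points form a convex set, only points whose stocks are levels have to be
  realised as flows; \<open>Q1 D\<close> lies in their hull.\<close>

lemma flow_points_eq_P1:
  assumes valid: "valid_data D"
  shows "flow_points D = P1 D"
proof (rule equalityI[OF flow_points_subset_P1[OF valid]])
  let ?C = "{p \<in> Q1 D. \<forall>t\<in>{1..horizon D}. s_val p t \<in> stock_levels D t}"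
  have "convex hull ?C \<subseteq> flow_points D"
    using level_point_in_flow_points[OF valid] by (intro hull_minimal convex_flow_points) blast
  moreover have "P1 D \<subseteq> convex hull ?C"
    unfolding P1_def by (intro hull_minimal Q1_subset_hull_stock_levels valid convex_convex_hull)
  ultimately show "P1 D \<subseteq> flow_points D" by blast
qed

section \<open>Size of the formulation\<close>

text \<open>The maximum with 1 accounts for the single node of layer 0, which
  \<open>max_levels\<close> does not count and which exceeds it if all level sets are empty.\<close>

lemma card_levels_le:
  assumes "t \<le> horizon D"
  shows "card (levels D t) \<le> max 1 (max_levels D)"
proof (cases "t = 0")
  case False
  then have "card (stock_levels D t) \<le> max_levels D"
    unfolding max_levels_def using assms by (intro Max_ge) auto
  then show ?thesis using False by (simp add: levels_def)
qed (simp add: levels_def)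

text \<open>An arc is given by two levels and two binaries, whence the factor 4.\<close>

lemma card_layered_arcs_le:
  "card (layered_arcs D) \<le> 4 * (horizon D * (max 1 (max_levels D))\<^sup>2)"
proof -
  let ?M = "max 1 (max_levels D)"
  have "card (arcs D t) \<le> 4 * ?M\<^sup>2" if "t \<in> {1..horizon D}" for t
  proof -
    have "card (arcs D t) \<le> card (levels D (t - 1) \<times> levels D t \<times> {0, 1::real} \<times> {0, 1::real})"
      by (intro card_mono arcs_subset) (simp add: finite_levels)
    also have "\<dots> = card (levels D (t - 1)) * card (levels D t) * 4"
      by (simp add: card_cartesian_product)
    also have "\<dots> \<le> ?M * ?M * 4"
      using that by (intro mult_mono card_levels_le) auto
    finally show ?thesis by (simp add: power2_eq_square)
  qed
  then have "(\<Sum>t=1..horizon D. card (arcs D t)) \<le> (\<Sum>t=1..horizon D. 4 * ?M\<^sup>2)"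
    by (rule sum_mono)
  then show ?thesis by (simp add: layered_arcs_def finite_arcs)
qed

lemma card_nodes_le: "card (nodes D) \<le> 1 + horizon D * max 1 (max_levels D)"
proof -
  let ?M = "max 1 (max_levels D)"
  have "card (nodes D) \<le> 1 + card (Sigma {1..<horizon D} (levels D))"
    unfolding nodes_def by (simp add: card_insert_if finite_levels)
  also have "card (Sigma {1..<horizon D} (levels D)) = (\<Sum>t\<in>{1..<horizon D}. card (levels D t))"
    by (simp add: finite_levels)
  also have "\<dots> \<le> (\<Sum>t\<in>{1..<horizon D}. ?M)"
    by (intro sum_mono card_levels_le) auto
  also have "\<dots> \<le> horizon D * ?M" by simp
  finally show ?thesis by simp
qed

theorem theorem4:
  shows "\<exists>C::nat. \<forall>D. valid_data D \<longrightarrow>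
           (\<exists>p cs. extended_formulation (horizon D) p cs (P1 D) \<and>
              5 * horizon D + p \<le> C * (horizon D * (max 1 (max_levels D))\<^sup>2) \<and>
              length cs \<le> C * (horizon D * (max 1 (max_levels D))\<^sup>2))"
proof (rule exI[of _ 11], intro allI impI)
  fix D assume valid: "valid_data D"
  let ?T = "horizon D" and ?M = "max 1 (max_levels D)"
  have "case_prod arc_point e \<in> point_space ?T" if "e \<in> layered_arcs D" for e
    using that by (auto simp: layered_arcs_def arc_point_def intro!: unit_point_in_point_space)
  from extended_formulation_of_weights[where W = "case_prod arc_point" and h = incidence
      and r = unit_supply, OF finite_layered_arcs[of D] finite_nodes[of D] this]
  obtain cs where len: "length cs = card (layered_arcs D) + card (nodes D) + 5 * ?T"
    and ext: "extended_formulation ?T (card (layered_arcs D)) cs (flow_points D)"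
    unfolding flow_points_def by blast
  have T: "1 \<le> ?T" using valid by (simp add: valid_data_def)
  have M: "?M \<le> ?M\<^sup>2" by (rule self_le_power) auto
  have "?T * 1 \<le> ?T * ?M\<^sup>2" using M by (intro mult_le_mono) auto
  moreover have "?T * ?M \<le> ?T * ?M\<^sup>2" using M by simp
  \<comment> \<open>11 is 5 + 4 + 1 + 1: coordinate equations, arcs, inner nodes and the source,
    each bounded by that multiple of \<open>?T * ?M\<^sup>2\<close> since \<open>?T\<close> and
    \<open>?M\<close> are at least 1.\<close>
  ultimately have "5 * ?T + card (layered_arcs D) \<le> 11 * (?T * ?M\<^sup>2)"
    "length cs \<le> 11 * (?T * ?M\<^sup>2)"
    using card_layered_arcs_le[of D] card_nodes_le[of D] T len by linarith+
  then show "\<exists>p cs. extended_formulation ?T p cs (P1 D) \<and>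
      5 * ?T + p \<le> 11 * (?T * ?M\<^sup>2) \<and> length cs \<le> 11 * (?T * ?M\<^sup>2)"
    using ext flow_points_eq_P1[OF valid] by auto
qed

end
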